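(* Let $\mathcal{H}$ be a real Hilbert space and let $f:\mathcal{H}\to\mathbb{R}$ be a convex, continuously Fréchet differentiable function whose gradient is $L$-Lipschitz continuous ($L>0$) and such that $\operatorname{argmin} f\neq\emptyset$. Let $a>0$, $c>0$, $0<q<1$, $0<p<2q$, and let $s\in\left(0,\frac1L\right)$ be fixed. Let $x_0,x_1\in\mathcal{H}$ and let $(x_k)$, $(y_k)$ be generated, for all $k\ge1$, by $$y_k=x_k+b_{k-1}(x_k-x_{k-1})-c_kx_k,\qquad x_{k+1}=y_k-s\nabla f(y_k)-\frac{cs}{k^p}y_k,$$ where $b_{k-1}=c_k=0$ (so $y_k=x_k$) if $k\in\left\{1,(cs)^{\frac1p},(cs)^{\frac1p}+1\right\}$, and otherwise $$b_{k-1}=\frac{k^p\left(a(k-1)^q-s\right)\left(a((k-1)^p-cs)^2(k-1)^q-2s(k-1)^{2p}\right)}{a^2(k-1)^{q+p}k^q\left((k-1)^p-cs\right)\left(k^p-cs\right)},$$ $$c_k=\frac{2s^2k^p\left((k-1)^pk^p-cs(k-1)^p-ac(k-1)^qk^p+ac(k-1)^{q+p}\right)}{a^2(k-1)^qk^q\left((k-1)^p-cs\right)\left(k^p-cs\right)^2}.$$ Then $(x_k)$ and $(y_k)$ converge strongly to $x^*$, where $x^*$ is the minimum norm element of $\operatorname{argmin} f$ (i.e. the metric projection of $0$ onto $\operatorname{argmin} f$). Further, as $k\to+\infty$, $$f_k(x_k)-f_k(\overline{x}_k)=o(k^{-p}),$$ $$f(x_k)-\min f=\mathcal{O}\left(k^{-p}\right),\qquad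 f(y_k)-\min f=\mathcal{O}\left(k^{-p}\right),$$ $$\|x_k-x_{k-1}\|=o\left(k^{-\frac p2}\right),$$ $$\|\nabla f(x_k)\|=o\left(k^{-\frac p2}\right),\qquad \|\nabla f(y_k)\|=o\left(k^{-\frac p2}\right).$$
   Context: For $k\ge1$, $f_k:\mathcal{H}\to\mathbb{R}$ denotes the strongly convex function $f_k(x)=f(x)+\frac{c}{2k^p}\|x\|^2$, and $\overline{x}_k$ denotes its unique minimizer. The constant $c>0$ is distinct from the sequence $(c_k)$. *)

theory Defs
  imports "HOL-Analysis.Analysis" "HOL-Library.Landau_Symbols"
begin

definition argmin :: "('a \<Rightarrow> real) \<Rightarrow> 'a set" where
  "argmin f = {x. is_arg_min f (\<lambda>_. True) x}"

definition tikhonov :: "('a::real_inner \<Rightarrow> real) \<Rightarrow> real \<Rightarrow> real \<Rightarrow> nat \<Rightarrow> 'a \<Rightarrow> real" where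
  "tikhonov f c p k x = f x + c / (2 * real k powr p) * (norm x)\<^sup>2"

definition tikhonov_min :: "('a::real_inner \<Rightarrow> real) \<Rightarrow> real \<Rightarrow> real \<Rightarrow> nat \<Rightarrow> 'a" where
  "tikhonov_min f c p k = (THE x. x \<in> argmin (tikhonov f c p k))"

text \<open>The indices at which the extrapolation is switched off. Apart from the start \<open>k = 1\<close>, these
  are the real numbers at which a denominator \<open>k\<^sup>p - c s\<close> or \<open>(k - 1)\<^sup>p - c s\<close> vanishes; they
  need not be integers.\<close>

definition exceptional :: "real \<Rightarrow> real \<Rightarrow> real \<Rightarrow> nat \<Rightarrow> bool" where
  "exceptional c s p k \<longleftrightarrow>
     real k \<in> {1, (c * s) powr (1 / p), (c * s) powr (1 / p) + 1}"

text \<open>\<open>b_prev a c s p q k\<close> is the coefficient \<open>b\<^bsub>k-1\<^esub>\<close>, i.e. the index is shifted by one. In both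
  definitions \<open>k - 1\<close> is a subtraction of real numbers.\<close>

definition b_prev :: "real \<Rightarrow> real \<Rightarrow> real \<Rightarrow> real \<Rightarrow> real \<Rightarrow> nat \<Rightarrow> real" where
  "b_prev a c s p q n =
     (if exceptional c s p n then 0
      else let k = real n in
        (k powr p * (a * (k - 1) powr q - s)
           * (a * ((k - 1) powr p - c * s)\<^sup>2 * (k - 1) powr q - 2 * s * (k - 1) powr (2 * p)))
        / (a\<^sup>2 * (k - 1) powr (q + p) * k powr q * ((k - 1) powr p - c * s) * (k powr p - c * s)))"

definition c_coef :: "real \<Rightarrow> real \<Rightarrow> real \<Rightarrow> real \<Rightarrow> real \<Rightarrow> nat \<Rightarrow> real" where
  "c_coef a c s p q n =
     (if exceptional c s p n then 0
      else let k = real n in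
        (2 * s\<^sup>2 * k powr p
           * ((k - 1) powr p * k powr p - c * s * (k - 1) powr p
              - a * c * (k - 1) powr q * k powr p + a * c * (k - 1) powr (q + p)))
        / (a\<^sup>2 * (k - 1) powr q * k powr q * ((k - 1) powr p - c * s) * (k powr p - c * s)\<^sup>2))"

end

theory Submission
  imports Defs "HOL-Real_Asymp.Real_Asymp"
begin

text \<open>The minimizers of the regularized functions \<open>f\<^sub>k\<close> converge strongly to the minimum norm
  minimizer \<open>xs\<close> of \<open>f\<close>. Put \<open>\<theta>\<^sub>k = (s / a) k\<^bsup>-q\<^esup>\<close>, \<open>h\<^sub>k = x\<^sub>k - xs\<close>, \<open>v\<^sub>k = x\<^sub>k - x\<^bsub>k-1\<^esub>\<close>, and consider
  the energy \<open>M\<^sub>k = 2s (f\<^sub>k(x\<^sub>k) - min f\<^sub>k) + (1 - 2\<theta>\<^bsub>k-1\<^esub>) |v\<^sub>k|\<^sup>2 + 2\<theta>\<^bsub>k-1\<^esub> \<langle>h\<^sub>k, v\<^sub>k\<rangle>\<close>.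
  The descent inequality of the gradient step, with comparison points \<open>x\<^sub>k\<close> and \<open>xs\<close> weighted by
  \<open>1 - \<theta>\<^sub>k\<close> and \<open>\<theta>\<^sub>k\<close>, and the asymptotics \<open>b\<^bsub>k-1\<^esub> = 1 - 3\<theta>\<^sub>k + o(\<theta>\<^sub>k)\<close>, \<open>c\<^sub>k = O(\<theta>\<^sub>k\<^sup>2)\<close> give
  \<open>M\<^bsub>k+1\<^esub> \<le> (1 - \<theta>\<^sub>k / 2) M\<^sub>k + o(k\<^bsup>-p-q\<^esup>)\<close>, hence \<open>M\<^sub>k = o(k\<^bsup>-p\<^esup>)\<close>. Since \<open>p < 2q\<close>, the cross term
  is negligible: by strong convexity of \<open>f\<^sub>k\<close>, \<open>\<theta>\<^sub>k |h\<^sub>k|\<close> is small against the square root of the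
  energy. So \<open>M\<^sub>k\<close> controls \<open>f\<^sub>k(x\<^sub>k) - min f\<^sub>k\<close> and \<open>|v\<^sub>k|\<^sup>2\<close>, and everything else follows.\<close>

section \<open>Convexity, smoothness and one regularized gradient step\<close>

lemma gderiv_along_line:
  assumes "GDERIV f (u + t *\<^sub>R d) :> g"
  shows "((\<lambda>t. f (u + t *\<^sub>R d)) has_real_derivative inner d g) (at t)"
proof -
  have "((\<lambda>t. u + t *\<^sub>R d) has_derivative (\<lambda>t. t *\<^sub>R d)) (at t)"
    by (auto intro!: derivative_eq_intros)
  then have "((\<lambda>t. f (u + t *\<^sub>R d)) has_derivative (\<lambda>r. inner (r *\<^sub>R d) g)) (at t)"
    using has_derivative_compose assms unfolding gderiv_def by blast
  then show ?thesis
    by (simp add: has_field_derivative_def mult_commute_abs)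
qed

text \<open>The restriction of \<open>f\<close> to the line through \<open>u\<close> and
  \<open>z\<close> is a convex function of one real variable, whose tangent at 0 lies below it at
  1.\<close>

lemma convex_gderiv_ge:
  assumes "convex_on UNIV f" and "GDERIV f u :> g"
  shows "f u + inner g (z - u) \<le> f z"
proof -
  let ?\<phi> = "\<lambda>t::real. f (u + t *\<^sub>R (z - u))"
  have "convex_on UNIV ?\<phi>"
  proof (rule convex_onI)
    fix t r r' :: real
    assume "0 < t" "t < 1"
    moreover have "u + ((1 - t) *\<^sub>R r + t *\<^sub>R r') *\<^sub>R (z - u)
        = (1 - t) *\<^sub>R (u + r *\<^sub>R (z - u)) + t *\<^sub>R (u + r' *\<^sub>R (z - u))"
      by (simp add: algebra_simps)
    ultimately show "?\<phi> ((1 - t) *\<^sub>R r + t *\<^sub>R r') \<le> (1 - t) * ?\<phi> r + t * ?\<phi> r'"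
      using convex_onD[OF assms(1), of t "u + r *\<^sub>R (z - u)" "u + r' *\<^sub>R (z - u)"] by simp
  qed simp
  moreover have "(?\<phi> has_real_derivative inner (z - u) g) (at 0)"
    using assms(2) by (intro gderiv_along_line) simp
  ultimately have "?\<phi> 1 - ?\<phi> 0 \<ge> inner (z - u) g * (1 - 0)"
    by (intro convex_on_imp_above_tangent[of UNIV]) auto
  then show ?thesis by (simp add: inner_commute)
qed

text \<open>This is the descent lemma. Instead of integrating the gradient along the segment, the
  proof subtracts the quadratic upper model and shows that the difference is nonincreasing in
  \<open>t\<close>.\<close>

lemma lipschitz_gderiv_le:
  assumes gr: "\<And>z. GDERIV f z :> grad z" and lip: "L-lipschitz_on UNIV grad"
  shows "f (u + d) \<le> f u + inner (grad u) d + L / 2 * (norm d)\<^sup>2"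
proof -
  let ?\<phi> = "\<lambda>t. f (u + t *\<^sub>R d) - t * inner (grad u) d - L / 2 * t\<^sup>2 * (norm d)\<^sup>2"
  have "?\<phi> 1 \<le> ?\<phi> 0"
  proof (rule DERIV_nonpos_imp_nonincreasing[of 0 1 ?\<phi>])
    fix t :: real assume "0 \<le> t"
    have "(?\<phi> has_real_derivative
        inner d (grad (u + t *\<^sub>R d)) - inner (grad u) d - L * t * (norm d)\<^sup>2) (at t)"
      by (rule derivative_eq_intros gderiv_along_line gr refl | simp)+
    moreover have "inner d (grad (u + t *\<^sub>R d)) - inner (grad u) d - L * t * (norm d)\<^sup>2 \<le> 0"
    proof -
      have "norm (grad (u + t *\<^sub>R d) - grad u) \<le> L * (t * norm d)"
        using lipschitz_onD[OF lip, of "u + t *\<^sub>R d" u] \<open>0 \<le> t\<close> by (simp add: dist_norm)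
      then have "norm d * norm (grad (u + t *\<^sub>R d) - grad u) \<le> norm d * (L * (t * norm d))"
        by (intro mult_left_mono) auto
      then have "inner d (grad (u + t *\<^sub>R d) - grad u) \<le> L * t * (norm d)\<^sup>2"
        using norm_cauchy_schwarz[of d "grad (u + t *\<^sub>R d) - grad u"]
        by (simp add: power2_eq_square algebra_simps)
      then show ?thesis
        by (simp add: inner_diff_right inner_commute)
    qed
    ultimately show "\<exists>y. (?\<phi> has_real_derivative y) (at t) \<and> y \<le> 0"
      by blast
  qed simp
  then show ?thesis by simp
qed

lemma power2_norm_add_scaleR:
  fixes u d :: "'a::real_inner"
  shows "(norm (u + r *\<^sub>R d))\<^sup>2 = (norm u)\<^sup>2 + 2 * r * inner u d + r\<^sup>2 * (norm d)\<^sup>2"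
  by (simp only: power2_norm_eq_inner) (simp add: algebra_simps inner_commute power2_eq_square)

text \<open>The regularized function has smoothness constant \<open>L + \<mu>\<close>, so the step
  size condition absorbs the second order terms. The comparison point \<open>z\<close> stays free,
  so that one step can be tested against several points.\<close>

lemma regularized_gradient_step_le:
  fixes f :: "'a::real_inner \<Rightarrow> real"
  assumes conv: "convex_on UNIV f" and gr: "\<And>z. GDERIV f z :> grad z"
    and lip: "L-lipschitz_on UNIV grad"
    and "0 \<le> \<mu>" "0 < s" "s * (L + \<mu>) \<le> 1"
    and G: "G = grad y + \<mu> *\<^sub>R y" and x': "x' = y - s *\<^sub>R G"
  shows "f x' + \<mu> / 2 * (norm x')\<^sup>2
    \<le> f z + \<mu> / 2 * (norm z)\<^sup>2 + inner G (y - z) - s / 2 * (norm G)\<^sup>2"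
proof -
  have "f x' \<le> f y - s * inner (grad y) G + L / 2 * (s\<^sup>2 * (norm G)\<^sup>2)"
    using lipschitz_gderiv_le[OF gr lip, of y "- s *\<^sub>R G"]
    by (simp add: x' power_mult_distrib)
  moreover have "f y \<le> f z + inner (grad y) (y - z)"
    using convex_gderiv_ge[OF conv gr, of y z] by (simp add: inner_diff_right)
  moreover have "\<mu> / 2 * (norm x')\<^sup>2
      = \<mu> / 2 * (norm y)\<^sup>2 - \<mu> * s * inner y G + \<mu> / 2 * (s\<^sup>2 * (norm G)\<^sup>2)"
  proof -
    have "(norm x')\<^sup>2 = (norm y)\<^sup>2 - 2 * s * inner y G + s\<^sup>2 * (norm G)\<^sup>2"
      using power2_norm_add_scaleR[of y "-s" G] by (simp add: x')
    then show ?thesis by (simp only:) (simp add: algebra_simps)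
  qed
  moreover have "\<mu> / 2 * (norm y)\<^sup>2 \<le> \<mu> / 2 * (norm z)\<^sup>2 + \<mu> * inner y (y - z)"
  proof -
    have "0 \<le> \<mu> / 2 * (norm (y - z))\<^sup>2" using \<open>0 \<le> \<mu>\<close> by simp
    then show ?thesis
      by (simp add: power2_norm_eq_inner inner_diff_left inner_diff_right inner_commute algebra_simps)
  qed
  moreover have "inner G (y - z) = inner (grad y) (y - z) + \<mu> * inner y (y - z)"
    by (simp add: G inner_add_left)
  moreover have "s * (norm G)\<^sup>2 = s * inner (grad y) G + \<mu> * s * inner y G"
    unfolding power2_norm_eq_inner
    by (subst (2) G) (simp add: inner_add_right inner_add_left algebra_simps inner_commute)
  moreover have "L * (s\<^sup>2 * (norm G)\<^sup>2) + \<mu> * (s\<^sup>2 * (norm G)\<^sup>2) \<le> s * (norm G)\<^sup>2"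
    using mult_right_mono[OF \<open>s * (L + \<mu>) \<le> 1\<close>, of "s * (norm G)\<^sup>2"] \<open>0 < s\<close>
    by (simp add: algebra_simps power2_eq_square)
  ultimately show ?thesis by linarith
qed

section \<open>Minimizers of the regularized functions\<close>

text \<open>Minimizing sequences are Cauchy by the parallelogram identity; the quadratic growth at the
  minimizer is the convexity inequality at the minimizer, where the gradient vanishes.\<close>

lemma regularized_minimizer_exists:
  fixes f :: "'a::{real_inner,complete_space} \<Rightarrow> real"
  assumes conv: "convex_on UNIV f" and gr: "\<And>z. GDERIV f z :> grad z"
    and bdd: "\<And>z. m \<le> f z" and "0 < \<mu>"
  obtains u where
    "\<And>z. f u + \<mu> / 2 * (norm u)\<^sup>2 + \<mu> / 2 * (norm (z - u))\<^sup>2 \<le> f z + \<mu> / 2 * (norm z)\<^sup>2"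
proof -
  define g where "g z = f z + \<mu> / 2 * (norm z)\<^sup>2" for z
  define I where "I = (INF z. g z)"
  have "bdd_below (range g)"
    using bdd \<open>0 < \<mu>\<close> unfolding g_def by (intro bdd_belowI[of _ m]) (auto intro!: add_increasing2)
  then have Ile: "I \<le> g z" for z
    unfolding I_def by (intro cINF_lower) auto
  have "\<exists>z. g z < I + 1 / real (Suc n)" for n
    using cInf_lessD[of "range g" "I + 1 / real (Suc n)"] unfolding I_def by auto
  then obtain u where u: "\<And>n. g (u n) < I + 1 / real (Suc n)" by metis
  have mid: "\<mu> / 4 * (norm (v - w))\<^sup>2 \<le> g v + g w - 2 * I" for v w
  proof -
    define m where "m = (1/2) *\<^sub>R (v + w)"
    have "(norm m)\<^sup>2 = ((norm v)\<^sup>2 + (norm w)\<^sup>2) / 2 - (norm (v - w))\<^sup>2 / 4"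
      unfolding power2_norm_eq_inner m_def
      by (simp add: field_simps inner_commute inner_diff_left inner_diff_right
          inner_add_left inner_add_right)
    then have "\<mu> / 2 * (norm m)\<^sup>2
        = \<mu> / 4 * (norm v)\<^sup>2 + \<mu> / 4 * (norm w)\<^sup>2 - \<mu> / 8 * (norm (v - w))\<^sup>2"
      by (simp only:) (simp add: field_simps)
    moreover have "f m \<le> (f v + f w) / 2"
      using convex_onD[OF conv, of "1/2" v w] by (simp add: m_def scaleR_add_right)
    ultimately show ?thesis
      using Ile[of m] unfolding g_def by (simp add: field_simps)
  qed
  have "Cauchy u"
  proof (rule metric_CauchyI)
    fix e :: real assume "0 < e"
    \<comment> \<open>\<open>mid\<close> adds two excesses over \<open>I\<close>; with each below
      \<open>\<mu> / 8 * e\<^sup>2\<close> the sum matches its factor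
      \<open>\<mu> / 4\<close>.\<close>
    then obtain N where N: "1 / real (Suc N) < \<mu> / 8 * e\<^sup>2"
      using \<open>0 < \<mu>\<close> nat_approx_posE[of "\<mu> / 8 * e\<^sup>2"] by auto
    have "dist (u i) (u j) < e" if "i \<ge> N" "j \<ge> N" for i j
    proof -
      have "1 / real (Suc i) \<le> 1 / real (Suc N)" "1 / real (Suc j) \<le> 1 / real (Suc N)"
        using that by (auto simp: field_simps)
      then have "\<mu> / 4 * (norm (u i - u j))\<^sup>2 < \<mu> / 4 * e\<^sup>2"
        using mid[of "u i" "u j"] u[of i] u[of j] N by linarith
      then show ?thesis
        using \<open>0 < \<mu>\<close> \<open>0 < e\<close> by (simp add: dist_norm power2_less_imp_less)
    qed
    then show "\<exists>M. \<forall>i\<ge>M. \<forall>j\<ge>M. dist (u i) (u j) < e" by blast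
  qed
  then obtain w where w: "u \<longlonglongrightarrow> w"
    using Cauchy_convergent convergent_def by blast
  have "isCont f w" using gr[of w] has_derivative_continuous unfolding gderiv_def by blast
  then have "(\<lambda>n. g (u n)) \<longlonglongrightarrow> g w"
    unfolding g_def using w by (intro tendsto_intros isCont_tendsto_compose[of w f])
  moreover have "(\<lambda>n. I + 1 / real (Suc n)) \<longlonglongrightarrow> I + 0"
    by (intro tendsto_intros LIMSEQ_Suc[OF lim_1_over_n])
  ultimately have "g w \<le> I"
    using LIMSEQ_le[of "\<lambda>n. g (u n)" "g w" "\<lambda>n. I + 1 / real (Suc n)" I] u
    by (auto intro: less_imp_le)
  then have wmin: "g w \<le> g z" for z using Ile[of z] by simp
  \<comment> \<open>First-order optimality, one direction at a time: on the line through
    \<open>w\<close> in direction \<open>d\<close> the function is \<open>?\<psi>\<close>, which has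
    a minimum at 0.\<close>
  have grad0: "inner d (grad w) + \<mu> * inner w d = 0" for d
  proof -
    let ?\<psi> = "\<lambda>t. f (w + t *\<^sub>R d) + \<mu> / 2 * ((norm w)\<^sup>2 + 2 * t * inner w d + t\<^sup>2 * (norm d)\<^sup>2)"
    have "((\<lambda>t. f (w + t *\<^sub>R d)) has_real_derivative inner d (grad w)) (at 0)"
      using gr by (intro gderiv_along_line) simp
    then have "(?\<psi> has_real_derivative inner d (grad w) + \<mu> * inner w d) (at 0)"
      by (auto intro!: derivative_eq_intros)
    moreover have "?\<psi> 0 \<le> ?\<psi> t" for t
      using wmin[of "w + t *\<^sub>R d"] by (simp add: g_def power2_norm_add_scaleR)
    ultimately show ?thesis
      using DERIV_local_min[of ?\<psi> _ 0 1] by auto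
  qed
  show ?thesis
  proof (rule that[of w])
    fix z
    have "f w + inner (grad w) (z - w) \<le> f z"
      by (rule convex_gderiv_ge[OF conv gr])
    moreover have "\<mu> / 2 * (norm z)\<^sup>2
        = \<mu> / 2 * (norm w)\<^sup>2 + \<mu> * inner w (z - w) + \<mu> / 2 * (norm (z - w))\<^sup>2"
    proof -
      have "(norm z)\<^sup>2 = (norm w)\<^sup>2 + 2 * inner w (z - w) + (norm (z - w))\<^sup>2"
        using power2_norm_add_scaleR[of w 1 "z - w"] by simp
      then show ?thesis by (simp only:) (simp add: algebra_simps)
    qed
    ultimately show "f w + \<mu> / 2 * (norm w)\<^sup>2 + \<mu> / 2 * (norm (z - w))\<^sup>2 \<le> f z + \<mu> / 2 * (norm z)\<^sup>2"
      using grad0[of "z - w"] inner_commute[of "z - w" "grad w"] by linarith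
  qed
qed

text \<open>For \<open>k \<le> l\<close>, adding the two minimality inequalities gives
  \<open>(norm (X l - X k))\<^sup>2 \<le> (norm (X l))\<^sup>2 - (norm (X k))\<^sup>2\<close>; as the norms are bounded, the
  path is Cauchy, and no weak compactness is needed.\<close>

lemma regularization_path_tendsto:
  fixes f :: "'a::{real_inner,complete_space} \<Rightarrow> real" and X :: "nat \<Rightarrow> 'a"
  assumes X: "\<And>k z. f (X k) + \<mu> k / 2 * (norm (X k))\<^sup>2 + \<mu> k / 2 * (norm (z - X k))\<^sup>2
      \<le> f z + \<mu> k / 2 * (norm z)\<^sup>2"
    and cont: "\<And>z. isCont f z" and ne: "argmin f \<noteq> {}"
    and pos: "\<And>k. 0 < \<mu> k" and dec: "decseq \<mu>" and lim: "\<mu> \<longlonglongrightarrow> 0"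
  obtains xs where "is_arg_min norm (\<lambda>z. z \<in> argmin f) xs" "X \<longlonglongrightarrow> xs"
proof -
  have argmin_iff: "u \<in> argmin f \<longleftrightarrow> (\<forall>z. f u \<le> f z)" for u
    by (simp add: argmin_def is_arg_min_linorder)
  \<comment> \<open>Since \<open>f z \<le> f (X k)\<close>, minimality of \<open>X k\<close> leaves
    a comparison of the quadratic terms only. This bounds the path and later shows that its limit
    has minimal norm.\<close>
  have le_argmin: "norm (X k) \<le> norm z" if "z \<in> argmin f" for k z
  proof -
    have "f z \<le> f (X k)" using that argmin_iff by blast
    then have "\<mu> k / 2 * (norm (X k))\<^sup>2 + \<mu> k / 2 * (norm (z - X k))\<^sup>2 \<le> \<mu> k / 2 * (norm z)\<^sup>2"
      using X[of k z] by linarith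
    moreover have "0 \<le> \<mu> k / 2 * (norm (z - X k))\<^sup>2" using pos[of k] by simp
    ultimately have "\<mu> k / 2 * (norm (X k))\<^sup>2 \<le> \<mu> k / 2 * (norm z)\<^sup>2" by linarith
    then have "(norm (X k))\<^sup>2 \<le> (norm z)\<^sup>2" using pos[of k] by simp
    then show ?thesis by simp
  qed
  have dist_le: "(norm (X l - X k))\<^sup>2 \<le> (norm (X l))\<^sup>2 - (norm (X k))\<^sup>2" if "k \<le> l" for k l
  proof (cases "\<mu> k = \<mu> l")
    \<comment> \<open>Division by \<open>\<mu> k - \<mu> l\<close> is impossible here, but both
      points minimize the same strongly convex function and so coincide.\<close>
    case True
    have "\<mu> k * (norm (X l - X k))\<^sup>2 \<le> 0"
      using X[of k "X l"] X[of l "X k"] True by (simp add: norm_minus_commute[of "X k"])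
    then have "X l = X k" using pos[of k]
      by (simp add: mult_le_0_iff)
    then show ?thesis by simp
  next
    case False
    have le: "\<mu> l < \<mu> k" using False dec that by (simp add: decseq_def order_less_le)
    let ?D = "(norm (X l - X k))\<^sup>2"
    have "(\<mu> k - \<mu> l) * ?D \<le> (\<mu> k + \<mu> l) * ?D"
      using pos[of l] by (intro mult_right_mono) auto
    also have "\<dots> \<le> (\<mu> k - \<mu> l) * ((norm (X l))\<^sup>2 - (norm (X k))\<^sup>2)"
      using X[of k "X l"] X[of l "X k"] by (simp add: norm_minus_commute[of "X k"] field_simps)
    finally show ?thesis using le by simp
  qed
  obtain z0 where z0: "z0 \<in> argmin f" using ne by blast
  have "incseq (\<lambda>k. (norm (X k))\<^sup>2)"
    unfolding incseq_def using dist_le by (smt (verit) zero_le_power2)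
  moreover have "(norm (X k))\<^sup>2 \<le> (norm z0)\<^sup>2" for k
    using le_argmin[OF z0] by (intro power_mono) auto
  ultimately have "convergent (\<lambda>k. (norm (X k))\<^sup>2)"
    using incseq_convergent unfolding convergent_def by metis
  then have cau: "Cauchy (\<lambda>k. (norm (X k))\<^sup>2)" by (rule convergent_Cauchy)
  have "Cauchy X"
  proof (rule metric_CauchyI)
    fix e :: real assume e: "0 < e"
    then obtain N where N: "\<And>i j. i \<ge> N \<Longrightarrow> j \<ge> N \<Longrightarrow> dist ((norm (X i))\<^sup>2) ((norm (X j))\<^sup>2) < e\<^sup>2"
      using metric_CauchyD[OF cau, of "e\<^sup>2"] by auto
    have *: "dist (X i) (X j) < e" if "i \<ge> N" "j \<ge> N" "i \<le> j" for i j
    proof -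
      have "(norm (X j - X i))\<^sup>2 < e\<^sup>2"
        using dist_le[OF that(3)] N[OF that(1,2)] by (simp add: dist_real_def)
      then show ?thesis using e
        by (simp add: dist_norm norm_minus_commute power2_less_imp_less)
    qed
    have "dist (X i) (X j) < e" if "i \<ge> N" "j \<ge> N" for i j
      using *[of i j] *[of j i] that by (metis dist_commute nat_le_linear)
    then show "\<exists>M. \<forall>i\<ge>M. \<forall>j\<ge>M. dist (X i) (X j) < e" by blast
  qed
  then obtain xs where xs: "X \<longlonglongrightarrow> xs"
    using Cauchy_convergent convergent_def by blast
  have "f xs \<le> f z0"
  proof (rule LIMSEQ_le[of "\<lambda>k. f (X k)" _ "\<lambda>k. f z0 + \<mu> k / 2 * (norm z0)\<^sup>2"])
    show "(\<lambda>k. f (X k)) \<longlonglongrightarrow> f xs" by (rule isCont_tendsto_compose[OF cont xs])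
    have "(\<lambda>k. f z0 + \<mu> k / 2 * (norm z0)\<^sup>2) \<longlonglongrightarrow> f z0 + 0 / 2 * (norm z0)\<^sup>2"
      by (intro tendsto_intros lim) simp
    then show "(\<lambda>k. f z0 + \<mu> k / 2 * (norm z0)\<^sup>2) \<longlonglongrightarrow> f z0" by simp
    have "f (X k) \<le> f z0 + \<mu> k / 2 * (norm z0)\<^sup>2" for k
    proof -
      have "0 \<le> \<mu> k / 2 * (norm (X k))\<^sup>2" "0 \<le> \<mu> k / 2 * (norm (z0 - X k))\<^sup>2"
        using pos[of k] by auto
      then show ?thesis using X[of k z0] by linarith
    qed
    then show "\<exists>N. \<forall>n\<ge>N. f (X n) \<le> f z0 + \<mu> n / 2 * (norm z0)\<^sup>2" by blast
  qed
  then have "xs \<in> argmin f" using z0 argmin_iff by (meson order_trans)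
  moreover have "norm xs \<le> norm z" if "z \<in> argmin f" for z
    using le_argmin[OF that] by (intro LIMSEQ_le_const2[OF tendsto_norm[OF xs]]) auto
  ultimately have "is_arg_min norm (\<lambda>z. z \<in> argmin f) xs"
    by (simp add: is_arg_min_linorder)
  then show ?thesis using xs that by blast
qed

section \<open>Energy estimates\<close>

text \<open>Written with \<open>norm (y - w)\<close> and \<open>norm (x' - w)\<close>, the gradient
  step becomes a three-point inequality for every \<open>w\<close>. It is used with weight
  \<open>1 - \<theta>\<close> at \<open>x\<close> and weight \<open>\<theta>\<close> at
  \<open>z\<close>; expanding the squared distances to \<open>z\<close> around \<open>x\<close> and
  \<open>x'\<close> produces the inner products.\<close>

lemma accelerated_step_energy:
  fixes f :: "'a::real_inner \<Rightarrow> real"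
  assumes conv: "convex_on UNIV f" and gr: "\<And>z. GDERIV f z :> grad z"
    and lip: "L-lipschitz_on UNIV grad"
    and \<mu>: "0 \<le> \<mu>" "0 < s" "s * (L + \<mu>) \<le> 1" and \<theta>: "0 \<le> \<theta>" "\<theta> \<le> 1"
    and x': "x' = y - s *\<^sub>R (grad y + \<mu> *\<^sub>R y)"
  shows "2 * s * (f x' + \<mu> / 2 * (norm x')\<^sup>2)
      + (1 - 2 * \<theta>) * (norm (x' - x))\<^sup>2 + 2 * \<theta> * inner (x' - z) (x' - x)
    \<le> 2 * s * ((1 - \<theta>) * (f x + \<mu> / 2 * (norm x)\<^sup>2) + \<theta> * (f z + \<mu> / 2 * (norm z)\<^sup>2))
      + (norm (y - x))\<^sup>2 + 2 * \<theta> * inner (x - z) (y - x)"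
proof -
  define G where "G = grad y + \<mu> *\<^sub>R y"
  define \<Phi> where "\<Phi> w = f w + \<mu> / 2 * (norm w)\<^sup>2" for w
  have step: "2 * s * \<Phi> x' \<le> 2 * s * \<Phi> w + (norm (y - w))\<^sup>2 - (norm (x' - w))\<^sup>2" for w
  proof -
    have "\<Phi> x' \<le> \<Phi> w + inner G (y - w) - s / 2 * (norm G)\<^sup>2"
      unfolding \<Phi>_def
      by (rule regularized_gradient_step_le[OF conv gr lip \<mu> G_def]) (simp add: x' G_def)
    from mult_left_mono[OF this, of "2 * s"]
    have "2 * s * \<Phi> x' \<le> 2 * s * \<Phi> w + 2 * s * inner G (y - w) - s\<^sup>2 * (norm G)\<^sup>2"
      using \<mu>(2) by (simp add: right_diff_distrib distrib_left power2_eq_square)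
    moreover have "(norm (x' - w))\<^sup>2 = (norm (y - w))\<^sup>2 - 2 * s * inner G (y - w) + s\<^sup>2 * (norm G)\<^sup>2"
    proof -
      have "x' - w = (y - w) + (- s) *\<^sub>R G" by (simp add: x' G_def)
      then show ?thesis
        by (simp only: power2_norm_add_scaleR) (simp add: inner_commute)
    qed
    ultimately show ?thesis by linarith
  qed
  \<comment> \<open>\<open>Y\<close>, \<open>V\<close>, \<open>I\<close>, \<open>J\<close> stand for
    the two squared norms and the two inner products, so that collecting terms is a polynomial
    identity. The coefficient \<open>1 - 2 * \<theta>\<close> is
    \<open>(1 - \<theta>) - \<theta>\<close>.\<close>
  have expand: "(1 - \<theta>) * (2 * s * \<Phi> x + Y - V) + \<theta> * (2 * s * \<Phi> z + (2 * I + Y - 2 * J + V))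
      = 2 * s * ((1 - \<theta>) * \<Phi> x + \<theta> * \<Phi> z) + Y + 2 * \<theta> * I - (1 - 2 * \<theta>) * V - 2 * \<theta> * J"
    for Y V I J :: real
    by algebra
  have "(1 - \<theta>) * (2 * s * \<Phi> x')
      \<le> (1 - \<theta>) * (2 * s * \<Phi> x + (norm (y - x))\<^sup>2 - (norm (x' - x))\<^sup>2)"
    using \<theta> step[of x] by (intro mult_left_mono) auto
  moreover have "\<theta> * (2 * s * \<Phi> x')
      \<le> \<theta> * (2 * s * \<Phi> z + (norm (y - z))\<^sup>2 - (norm (x' - z))\<^sup>2)"
    using \<theta> step[of z] by (intro mult_left_mono) auto
  moreover have "(norm (y - z))\<^sup>2 - (norm (x' - z))\<^sup>2
      = 2 * inner (x - z) (y - x) + (norm (y - x))\<^sup>2 - 2 * inner (x' - z) (x' - x) + (norm (x' - x))\<^sup>2"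
    using power2_norm_add_scaleR[of "x - z" 1 "y - x"]
      power2_norm_add_scaleR[of "x' - z" "-1" "x' - x"] by simp
  ultimately have "(1 - \<theta>) * (2 * s * \<Phi> x') + \<theta> * (2 * s * \<Phi> x')
      \<le> (1 - \<theta>) * (2 * s * \<Phi> x + (norm (y - x))\<^sup>2 - (norm (x' - x))\<^sup>2)
        + \<theta> * (2 * s * \<Phi> z + (2 * inner (x - z) (y - x) + (norm (y - x))\<^sup>2
            - 2 * inner (x' - z) (x' - x) + (norm (x' - x))\<^sup>2))"
    by (metis add_diff_eq add_mono)
  moreover have "(1 - \<theta>) * (2 * s * \<Phi> x') + \<theta> * (2 * s * \<Phi> x') = 2 * s * \<Phi> x'"
    by (simp only: distrib_right[symmetric]) simp
  ultimately show ?thesis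
    using expand[of "(norm (y - x))\<^sup>2" "(norm (x' - x))\<^sup>2" "inner (x - z) (y - x)" "inner (x' - z) (x' - x)"]
    unfolding \<Phi>_def by linarith
qed

text \<open>Scaled by \<open>k powr p\<close> the recurrence still contracts, at rate
  \<open>A / 2\<close>: the growth factor \<open>((k + 1) / k) powr p\<close> is
  \<open>1 + O(1 / k)\<close>, and \<open>1 / k\<close> is negligible against
  \<open>k powr (-q)\<close> because \<open>q < 1\<close>. \<open>M\<close> may be negative, hence
  the truncation at 0.\<close>

lemma powr_recurrence_tendsto_0:
  fixes M \<epsilon> :: "nat \<Rightarrow> real"
  assumes q: "0 < q" "q < 1" and "0 < p" and A: "0 < A"
    and rec: "\<forall>\<^sub>F k in sequentially.
      M (Suc k) \<le> (1 - A * real k powr (-q)) * M k + \<epsilon> k * real k powr (-p - q)"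
    and eps: "\<epsilon> \<longlonglongrightarrow> 0"
  shows "(\<lambda>k. real k powr p * max 0 (M k)) \<longlonglongrightarrow> 0"
proof (rule tendstoI)
  define u where "u k = real k powr p * max 0 (M k)" for k
  fix e :: real assume e: "0 < e"
  have ev1: "\<forall>\<^sub>F k in sequentially. 1 - A * real k powr (-q) \<ge> 0"
    using q A by real_asymp
  have ev2: "\<forall>\<^sub>F k in sequentially. (1 - A * real k powr (-q)) * ((real k + 1) / real k) powr p
      \<le> 1 - A / 2 * real k powr (-q)"
    using q A \<open>0 < p\<close> by real_asymp
  have ev3: "\<forall>\<^sub>F k in sequentially. (real k + 1) powr p * real k powr (-p) \<le> 2"
    using \<open>0 < p\<close> by real_asymp
  have ev4: "\<forall>\<^sub>F k in sequentially. 1 - A / 2 * real k powr (-q) \<le> real k / (real k + 1)"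
    using q A by real_asymp
  have "(\<lambda>k. 2 * \<bar>\<epsilon> k\<bar>) \<longlonglongrightarrow> 0"
    by (intro tendsto_mult_right_zero tendsto_rabs_zero eps)
  then have ev5: "\<forall>\<^sub>F k in sequentially. 2 * \<bar>\<epsilon> k\<bar> < A * e / 4"
    using A e by (intro order_tendstoD(2)[of _ 0]) auto
  \<comment> \<open>At the level \<open>e / 2\<close> the contraction balances the bound
    \<open>A * e / 4\<close> on the error. Replacing the contraction factor by the larger
    \<open>k / (k + 1)\<close> makes \<open>k\<close> times the excess over this level
    nonincreasing, so the excess tends to 0.\<close>
  have "\<forall>\<^sub>F k in sequentially. real (Suc k) * max 0 (u (Suc k) - e / 2) \<le> real k * max 0 (u k - e / 2)"
    using rec ev1 ev2 ev3 ev4 ev5 eventually_gt_at_top[of 0]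
  proof eventually_elim
    case (elim k)
    let ?\<theta> = "real k powr (-q)"
    have \<theta>0: "0 \<le> ?\<theta>" by simp
    have "M (Suc k) \<le> (1 - A * ?\<theta>) * max 0 (M k) + \<bar>\<epsilon> k\<bar> * real k powr (-p - q)"
      using elim(1,2) mult_left_mono[of "M k" "max 0 (M k)" "1 - A * ?\<theta>"]
        mult_right_mono[OF abs_ge_self[of "\<epsilon> k"], of "real k powr (-p - q)"] by simp
    moreover have "0 \<le> (1 - A * ?\<theta>) * max 0 (M k) + \<bar>\<epsilon> k\<bar> * real k powr (-p - q)"
      using elim(2) by simp
    ultimately have "u (Suc k) \<le> (real k + 1) powr p
        * ((1 - A * ?\<theta>) * max 0 (M k) + \<bar>\<epsilon> k\<bar> * real k powr (-p - q))"
      unfolding u_def by (intro mult_mono) (auto simp: add.commute)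
    also have "\<dots> = (1 - A * ?\<theta>) * ((real k + 1) / real k) powr p * u k
        + ((real k + 1) powr p * real k powr (-p)) * \<bar>\<epsilon> k\<bar> * ?\<theta>"
      using elim(7) by (simp add: u_def powr_divide powr_diff powr_minus field_simps)
    also have "\<dots> \<le> (1 - A / 2 * ?\<theta>) * u k + 2 * \<bar>\<epsilon> k\<bar> * ?\<theta>"
      using elim(3,4) by (intro add_mono mult_right_mono) (auto simp: u_def)
    also have "\<dots> \<le> (1 - A / 2 * ?\<theta>) * u k + A * e / 4 * ?\<theta>"
      using elim(6) \<theta>0 by (intro add_left_mono mult_right_mono) auto
    finally have *: "u (Suc k) - e / 2 \<le> (1 - A / 2 * ?\<theta>) * (u k - e / 2)"
      by (simp add: algebra_simps diff_divide_distrib)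
    have "0 \<le> A * ?\<theta>" using A \<theta>0 by simp
    then have "1 - A / 2 * ?\<theta> \<ge> 0" using elim(2) by linarith
    then have "(1 - A / 2 * ?\<theta>) * (u k - e / 2) \<le> (1 - A / 2 * ?\<theta>) * max 0 (u k - e / 2)"
      by (intro mult_left_mono) auto
    also have "\<dots> \<le> real k / (real k + 1) * max 0 (u k - e / 2)"
      using elim(5) by (intro mult_right_mono) auto
    finally have "max 0 (u (Suc k) - e / 2) \<le> real k / (real k + 1) * max 0 (u k - e / 2)"
      using * by simp
    moreover have "(1 + real k) * w' \<le> real k * w" if "w' \<le> real k / (real k + 1) * w" for w w' :: real
      using that by (simp add: field_simps)
    ultimately show ?case by (simp only: of_nat_Suc)
  qed
  then obtain N where N: "\<And>k. k \<ge> N \<Longrightarrow>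
      real (Suc k) * max 0 (u (Suc k) - e / 2) \<le> real k * max 0 (u k - e / 2)"
    by (auto simp: eventually_sequentially)
  have bound: "real k * max 0 (u k - e / 2) \<le> real N * max 0 (u N - e / 2)" if "k \<ge> N" for k
    using that
  proof (induction k rule: dec_induct)
    case (step n)
    then show ?case using N[of n] by linarith
  qed simp
  have "\<forall>\<^sub>F k in sequentially. real N * max 0 (u N - e / 2) < real k * (e / 2)"
    using e by real_asymp
  then show "\<forall>\<^sub>F k in sequentially. dist (real k powr p * max 0 (M k)) 0 < e"
    using eventually_ge_at_top[of N] eventually_gt_at_top[of 0]
  proof eventually_elim
    case (elim k)
    then have "real k * max 0 (u k - e / 2) < real k * (e / 2)" using bound[of k] by linarith
    then have "max 0 (u k - e / 2) < e / 2" using elim(3) by (simp only: mult_less_cancel_left_pos of_nat_0_less_iff)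
    then have "u k - e / 2 < e / 2" by linarith
    moreover have "0 \<le> u k" by (simp add: u_def)
    ultimately show ?case by (simp add: u_def)
  qed
qed

text \<open>The loss of at least \<open>5 * \<theta>\<close> in \<open>b\<^sup>2\<close> exceeds the
  roughly \<open>3 * \<theta>\<close> that the coefficient
  \<open>(1 - \<theta>) * (1 - 2 * \<theta>')\<close> gives away. The coefficients of
  \<open>inner h v\<close> on both sides agree up to order \<open>\<theta>\<^sup>2\<close>. Young's
  inequality charges the remaining terms containing \<open>v\<close> to the surplus and leaves
  errors of order \<open>\<theta>^3\<close>.\<close>

lemma energy_step:
  fixes h v h' v' z d :: "'a::real_inner"
  assumes \<theta>: "0 < \<theta>" "\<theta> \<le> 1/2" "\<theta> \<le> \<theta>'" "\<theta>' - \<theta> \<le> \<theta>\<^sup>2"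
    and b: "0 \<le> b" "b \<le> 1" "b\<^sup>2 \<le> 1 - 5 * \<theta>" "1 - b \<le> 4 * \<theta>" and \<gamma>: "\<bar>\<gamma>\<bar> \<le> C * \<theta>\<^sup>2"
    and d: "d = b *\<^sub>R v - \<gamma> *\<^sub>R (h + z)"
  shows "(norm d)\<^sup>2 + 2 * \<theta> * inner h d
    \<le> (1 - \<theta>) * ((1 - 2 * \<theta>') * (norm v)\<^sup>2 + 2 * \<theta>' * inner h v)
      + (10 * C\<^sup>2 + 3 * C + 196) * \<theta>^3 * ((norm h)\<^sup>2 + (norm z)\<^sup>2)"
proof -
  define V H X where "V = norm v" and "H = norm h" and "X = norm (h + z)"
  have nn: "0 \<le> V" "0 \<le> H" "0 \<le> X" by (simp_all add: V_def H_def X_def)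
  have "0 \<le> C * \<theta>\<^sup>2" using \<gamma> by linarith
  then have C: "0 \<le> C" using \<theta>(1) by (simp add: zero_le_mult_iff)
  have sq: "\<theta>\<^sup>2 \<le> \<theta> / 2"
    using mult_left_mono[OF \<theta>(2), of \<theta>] \<theta>(1) by (simp add: power2_eq_square)
  have cs: "\<bar>inner v (h + z)\<bar> \<le> V * X" "\<bar>inner h v\<bar> \<le> H * V" "\<bar>inner h (h + z)\<bar> \<le> H * X"
    unfolding V_def H_def X_def by (rule Cauchy_Schwarz_ineq2)+
  have X2: "X\<^sup>2 \<le> 2 * H\<^sup>2 + 2 * (norm z)\<^sup>2"
  proof -
    have "0 \<le> (norm (h - z))\<^sup>2" by simp
    then show ?thesis unfolding X_def H_def power2_norm_eq_inner
      by (simp add: inner_add_left inner_add_right inner_diff_left inner_diff_right inner_commute)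
  qed
  have d2: "(norm d)\<^sup>2 = b\<^sup>2 * V\<^sup>2 - 2 * b * \<gamma> * inner v (h + z) + \<gamma>\<^sup>2 * X\<^sup>2"
    unfolding d V_def X_def power2_norm_eq_inner
    by (simp add: inner_diff_left inner_diff_right inner_commute algebra_simps power2_eq_square)
  have t1: "b\<^sup>2 * V\<^sup>2 \<le> (1 - 5 * \<theta>) * V\<^sup>2" using b(3) by (rule mult_right_mono) simp
  have t2: "- (2 * b * \<gamma> * inner v (h + z)) \<le> \<theta> / 4 * V\<^sup>2 + 4 * C\<^sup>2 * \<theta>^3 * X\<^sup>2"
  proof -
    have "\<bar>b * (\<gamma> * inner v (h + z))\<bar> \<le> 1 * ((C * \<theta>\<^sup>2) * (V * X))"
      unfolding abs_mult using b \<gamma> cs(1) \<open>0 \<le> C * \<theta>\<^sup>2\<close> by (intro mult_mono) auto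
    moreover have "0 \<le> \<theta> * (V / 2 - 2 * C * \<theta> * X)\<^sup>2" using \<theta>(1) by simp
    moreover have "\<theta> * (V / 2 - 2 * C * \<theta> * X)\<^sup>2
        = \<theta> / 4 * V\<^sup>2 - 2 * ((C * \<theta>\<^sup>2) * (V * X)) + 4 * C\<^sup>2 * \<theta>^3 * X\<^sup>2"
      by (simp add: power2_eq_square power3_eq_cube field_simps)
    ultimately show ?thesis by linarith
  qed
  have "\<theta>^4 \<le> \<theta>^3" using \<theta> by (intro power_decreasing) auto
  then have t3: "\<gamma>\<^sup>2 * X\<^sup>2 \<le> C\<^sup>2 * \<theta>^3 * X\<^sup>2"
  proof -
    have "\<gamma>\<^sup>2 \<le> (C * \<theta>\<^sup>2)\<^sup>2" using \<gamma> by (simp add: abs_le_square_iff[symmetric] \<open>0 \<le> C * \<theta>\<^sup>2\<close> C)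
    also have "\<dots> = C\<^sup>2 * \<theta>^4" by (simp add: power_mult_distrib)
    also have "\<dots> \<le> C\<^sup>2 * \<theta>^3" using \<open>\<theta>^4 \<le> \<theta>^3\<close> by (intro mult_left_mono) auto
    finally show ?thesis by (intro mult_right_mono) auto
  qed
  have hd: "2 * \<theta> * inner h d
      = 2 * (1 - \<theta>) * \<theta>' * inner h v + 2 * (\<theta> * b - (1 - \<theta>) * \<theta>') * inner h v
        - 2 * \<theta> * \<gamma> * inner h (h + z)"
    by (simp add: d inner_diff_right algebra_simps)
  \<comment> \<open>7 is the sum of the bounds 4, 2 and 1 for the three parts of the mismatch.
    Completing the square spends \<open>\<theta> / 4\<close> of the surplus, as in
    \<open>t2\<close>, and 196 is the square of 14.\<close>
  have t4: "2 * (\<theta> * b - (1 - \<theta>) * \<theta>') * inner h v \<le> \<theta> / 4 * V\<^sup>2 + 196 * \<theta>^3 * H\<^sup>2"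
  proof -
    have "\<theta> * (1 - b) \<le> \<theta> * (4 * \<theta>)" "0 \<le> \<theta> * (1 - b)"
      using \<theta>(1) b by (auto intro!: mult_left_mono)
    moreover have "\<theta> * \<theta>' \<le> \<theta> * (2 * \<theta>)" "0 \<le> \<theta> * \<theta>'"
      using \<theta> sq by (auto intro!: mult_left_mono)
    moreover have "\<theta> * b - (1 - \<theta>) * \<theta>' = \<theta> * \<theta>' - \<theta> * (1 - b) - (\<theta>' - \<theta>)"
      by (simp add: algebra_simps)
    moreover have "\<theta> * (4 * \<theta>) = 4 * \<theta>\<^sup>2" "\<theta> * (2 * \<theta>) = 2 * \<theta>\<^sup>2"
      by (simp_all add: power2_eq_square)
    ultimately have "\<bar>\<theta> * b - (1 - \<theta>) * \<theta>'\<bar> \<le> 7 * \<theta>\<^sup>2"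
      using \<theta>(3,4) zero_le_power2[of \<theta>] by linarith
    then have "\<bar>\<theta> * b - (1 - \<theta>) * \<theta>'\<bar> * \<bar>inner h v\<bar> \<le> 7 * \<theta>\<^sup>2 * (H * V)"
      using cs(2) by (intro mult_mono) auto
    then have "(\<theta> * b - (1 - \<theta>) * \<theta>') * inner h v \<le> 7 * \<theta>\<^sup>2 * (H * V)"
      unfolding abs_mult[symmetric] by linarith
    moreover have "0 \<le> \<theta> * (V / 2 - 14 * \<theta> * H)\<^sup>2" using \<theta>(1) by simp
    moreover have "\<theta> * (V / 2 - 14 * \<theta> * H)\<^sup>2
        = \<theta> / 4 * V\<^sup>2 - 2 * (7 * \<theta>\<^sup>2 * (H * V)) + 196 * \<theta>^3 * H\<^sup>2"
      by (simp add: power2_eq_square power3_eq_cube field_simps)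
    ultimately show ?thesis by linarith
  qed
  have t5: "- (2 * \<theta> * \<gamma> * inner h (h + z)) \<le> C * \<theta>^3 * (H\<^sup>2 + X\<^sup>2)"
  proof -
    have "\<bar>\<gamma> * inner h (h + z)\<bar> \<le> (C * \<theta>\<^sup>2) * (H * X)"
      unfolding abs_mult using \<gamma> cs(3) \<open>0 \<le> C * \<theta>\<^sup>2\<close> by (intro mult_mono) auto
    then have "- (\<gamma> * inner h (h + z)) \<le> (C * \<theta>\<^sup>2) * (H * X)" by linarith
    from mult_left_mono[OF this, of "2 * \<theta>"]
    have "- (2 * \<theta> * \<gamma> * inner h (h + z)) \<le> C * \<theta>^3 * (2 * H * X)"
      using \<theta>(1) by (simp add: power2_eq_square power3_eq_cube algebra_simps)
    also have "\<dots> \<le> C * \<theta>^3 * (H\<^sup>2 + X\<^sup>2)"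
      using C \<theta>(1) sum_squares_bound[of H X] by (intro mult_left_mono) auto
    finally show ?thesis .
  qed
  \<comment> \<open>After both charges the left coefficient is \<open>1 - 9/2 * \<theta>\<close>,
    while the right one is at least \<open>1 - 3 * \<theta>\<close>.\<close>
  have t6: "(1 - 5 * \<theta>) * V\<^sup>2 + \<theta> / 4 * V\<^sup>2 + \<theta> / 4 * V\<^sup>2 \<le> (1 - \<theta>) * (1 - 2 * \<theta>') * V\<^sup>2"
  proof -
    have "\<theta>\<^sup>2 \<le> \<theta> * \<theta>'" using \<theta> by (simp add: power2_eq_square)
    then have "1 - 5 * \<theta> + \<theta> / 2 \<le> (1 - \<theta>) * (1 - 2 * \<theta>')"
      using \<theta>(1,4) sq by (simp add: algebra_simps)
    from mult_right_mono[OF this, of "V\<^sup>2"] show ?thesis by (simp add: algebra_simps)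
  qed
  \<comment> \<open>\<open>X2\<close> doubles \<open>5 * C\<^sup>2 + C\<close>; the third
    \<open>C\<close> is the \<open>H\<^sup>2\<close> part of \<open>t5\<close>.\<close>
  have t7: "(5 * C\<^sup>2 + C) * \<theta>^3 * X\<^sup>2 + (196 + C) * \<theta>^3 * H\<^sup>2
      \<le> (10 * C\<^sup>2 + 3 * C + 196) * \<theta>^3 * (H\<^sup>2 + (norm z)\<^sup>2)"
  proof -
    have "(5 * C\<^sup>2 + C) * \<theta>^3 * X\<^sup>2 \<le> (5 * C\<^sup>2 + C) * \<theta>^3 * (2 * H\<^sup>2 + 2 * (norm z)\<^sup>2)"
      using X2 C \<theta>(1) by (intro mult_left_mono) auto
    moreover have "0 \<le> C * \<theta>^3 * (norm z)\<^sup>2" "0 \<le> \<theta>^3 * (norm z)\<^sup>2" using C \<theta>(1) by auto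
    ultimately show ?thesis by (simp add: algebra_simps)
  qed
  have "(norm d)\<^sup>2 + 2 * \<theta> * inner h d
     \<le> (1 - \<theta>) * (1 - 2 * \<theta>') * V\<^sup>2 + 2 * (1 - \<theta>) * \<theta>' * inner h v
       + ((5 * C\<^sup>2 + C) * \<theta>^3 * X\<^sup>2 + (196 + C) * \<theta>^3 * H\<^sup>2)"
  proof -
    have "(5 * C\<^sup>2 + C) * \<theta>^3 * X\<^sup>2 + (196 + C) * \<theta>^3 * H\<^sup>2
        = 4 * C\<^sup>2 * \<theta>^3 * X\<^sup>2 + C\<^sup>2 * \<theta>^3 * X\<^sup>2 + C * \<theta>^3 * (H\<^sup>2 + X\<^sup>2) + 196 * \<theta>^3 * H\<^sup>2"
      by algebra
    then show ?thesis using d2 t1 t2 t3 hd t4 t5 t6 by linarith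
  qed
  also have "\<dots> \<le> (1 - \<theta>) * (1 - 2 * \<theta>') * V\<^sup>2 + 2 * (1 - \<theta>) * \<theta>' * inner h v
       + (10 * C\<^sup>2 + 3 * C + 196) * \<theta>^3 * (H\<^sup>2 + (norm z)\<^sup>2)"
    using t7 by simp
  finally show ?thesis by (simp add: V_def H_def algebra_simps)
qed

text \<open>As \<open>\<theta> \<le> 1/4\<close>, at least half of \<open>(norm v)\<^sup>2\<close>
  is available, and Young's inequality spends half of that on the cross term.\<close>

lemma energy_lower_bound:
  fixes h v :: "'a::real_inner"
  assumes "0 \<le> \<theta>" "\<theta> \<le> 1/4"
  shows "(norm v)\<^sup>2 / 4 - 4 * \<theta>\<^sup>2 * (norm h)\<^sup>2 \<le> (1 - 2 * \<theta>) * (norm v)\<^sup>2 + 2 * \<theta> * inner h v"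
proof -
  have "\<theta> * (norm v)\<^sup>2 \<le> 1/4 * (norm v)\<^sup>2" using assms by (intro mult_right_mono) auto
  moreover have "- (\<theta> * inner h v) \<le> \<theta> * (norm h * norm v)"
  proof -
    have "- inner h v \<le> norm h * norm v" using Cauchy_Schwarz_ineq2[of h v] by linarith
    from mult_left_mono[OF this assms(1)] show ?thesis by simp
  qed
  moreover have "0 \<le> (norm v / 2 - 2 * \<theta> * norm h)\<^sup>2" by simp
  ultimately show ?thesis by (simp add: power2_eq_square algebra_simps)
qed

text \<open>The recursion is separated from the algorithm: \<open>F\<close> is the scaled gap,
  \<open>d\<close> the extrapolation, \<open>\<delta>\<close> the drift, and \<open>h_bound\<close>
  is what strong convexity provides. As \<open>p < 2 * q\<close>, the product
  \<open>\<theta>\<^sup>2 * k powr p\<close> vanishes; hence in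
  \<open>\<theta>^3 * (norm h)\<^sup>2\<close> the part with \<open>F\<close> is a small multiple of
  \<open>\<theta> * F\<close>, and the rest is \<open>o(k powr (-p - q))\<close>.\<close>

lemma energy_decay:
  fixes h v :: "nat \<Rightarrow> 'a::real_inner" and F b \<gamma> \<delta> \<theta> :: "nat \<Rightarrow> real"
  assumes q: "0 < q" "q < 1" and p: "0 < p" "p < 2 * q" and \<sigma>: "0 < \<sigma>"
    and \<theta>: "\<And>k. \<theta> k = \<sigma> * real k powr (-q)"
    and b_lim: "(\<lambda>k. real k powr q * (b k - 1)) \<longlonglongrightarrow> - (3 * \<sigma>)"
    and \<gamma>_lim: "(\<lambda>k. real k powr (2 * q) * \<gamma> k) \<longlonglongrightarrow> g"
    and F_nonneg: "\<forall>\<^sub>F k in sequentially. 0 \<le> F k"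
    and C: "0 \<le> C1" "0 \<le> C2"
    and h_bound: "\<forall>\<^sub>F k in sequentially. (norm (h k))\<^sup>2 \<le> C1 * (real k powr p * F k) + C2"
    and \<delta>_lim: "(\<lambda>k. real k powr (p + q) * \<delta> k) \<longlonglongrightarrow> 0"
    and d: "\<And>k. d k = b k *\<^sub>R v k - \<gamma> k *\<^sub>R (h k + z)"
    and step: "\<forall>\<^sub>F k in sequentially.
      F (Suc k) + (1 - 2 * \<theta> k) * (norm (v (Suc k)))\<^sup>2 + 2 * \<theta> k * inner (h (Suc k)) (v (Suc k))
      \<le> (1 - \<theta> k) * F k + (norm (d k))\<^sup>2 + 2 * \<theta> k * inner (h k) (d k) + \<delta> k"
  shows "(\<lambda>k. real k powr p * F k) \<longlonglongrightarrow> 0" "(\<lambda>k. real k powr p * (norm (v k))\<^sup>2) \<longlonglongrightarrow> 0"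
proof -
  \<comment> \<open>\<open>\<theta>'\<close> is \<open>\<theta>\<close> at the previous index, with
    subtraction of real numbers; in \<open>M (Suc k)\<close> it becomes
    \<open>\<theta> k\<close>.\<close>
  define \<theta>' where "\<theta>' k = \<sigma> * (real k - 1) powr (-q)" for k :: nat
  define M where "M k = F k + (1 - 2 * \<theta>' k) * (norm (v k))\<^sup>2 + 2 * \<theta>' k * inner (h k) (v k)" for k
  define C where "C = (\<bar>g\<bar> + 1) / \<sigma>\<^sup>2"
  define K where "K = 10 * C\<^sup>2 + 3 * C + 196"
  have "0 \<le> C" by (simp add: C_def)
  then have K: "0 \<le> K" by (simp add: K_def)
  \<comment> \<open>\<open>8 * C2\<close> is a quarter of the \<open>32 * C2\<close> that arises
    when \<open>F\<close> is bounded by the energy.\<close>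
  define K2 where "K2 = K * (C2 + (norm z)\<^sup>2) + 8 * C2"
  have \<theta>_shift: "\<theta>' (Suc k) = \<theta> k" for k by (simp add: \<theta>'_def \<theta>)

  have ev_\<theta>: "\<forall>\<^sub>F k in sequentially. \<theta> k \<le> 1/16" unfolding \<theta> using q \<sigma> by real_asymp
  have ev_\<theta>': "\<forall>\<^sub>F k in sequentially. \<theta>' k \<le> 1/4" unfolding \<theta>'_def using q \<sigma> by real_asymp
  have ev_mono: "\<forall>\<^sub>F k in sequentially. \<theta> k \<le> \<theta>' k" unfolding \<theta> \<theta>'_def using q \<sigma> by real_asymp
  have ev_diff: "\<forall>\<^sub>F k in sequentially. \<theta>' k - \<theta> k \<le> (\<theta> k)\<^sup>2" unfolding \<theta> \<theta>'_def using q \<sigma> by real_asymp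
  have ev_double: "\<forall>\<^sub>F k in sequentially. \<theta>' k \<le> 2 * \<theta> k" unfolding \<theta> \<theta>'_def using q \<sigma> by real_asymp
  have \<theta>2_lim: "(\<lambda>k. (\<theta> k)\<^sup>2 * real k powr p) \<longlonglongrightarrow> 0" unfolding \<theta> using q p \<sigma> by real_asymp
  have \<theta>3_lim: "(\<lambda>k. real k powr (p + q) * (\<theta> k)^3) \<longlonglongrightarrow> 0" unfolding \<theta> using q p \<sigma> by real_asymp
  have ev_small: "\<forall>\<^sub>F k in sequentially. c * ((\<theta> k)\<^sup>2 * real k powr p) < e" if "0 < e" for c e
    using order_tendstoD(2)[OF tendsto_mult_right_zero[OF \<theta>2_lim], of e c] that by simp
  \<comment> \<open>The limit \<open>- (3 * \<sigma>)\<close> lies strictly between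
    \<open>- (4 * \<sigma>)\<close> and \<open>- (11 / 4 * \<sigma>)\<close>. The square of
    \<open>1 - 11 / 4 * \<theta> k\<close> is at most \<open>1 - 5 * \<theta> k\<close> because
    \<open>\<theta> k \<le> 1/16\<close>.\<close>
  have ev_b: "\<forall>\<^sub>F k in sequentially. 0 \<le> b k \<and> b k \<le> 1 \<and> (b k)\<^sup>2 \<le> 1 - 5 * \<theta> k \<and> 1 - b k \<le> 4 * \<theta> k"
  proof -
    have "\<forall>\<^sub>F k in sequentially. - (4 * \<sigma>) < real k powr q * (b k - 1)"
      using \<sigma> by (intro order_tendstoD(1)[OF b_lim]) simp
    moreover have "\<forall>\<^sub>F k in sequentially. real k powr q * (b k - 1) < - (11 / 4 * \<sigma>)"
      using \<sigma> by (intro order_tendstoD(2)[OF b_lim]) simp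
    ultimately show ?thesis using ev_\<theta> eventually_gt_at_top[of 0]
    proof eventually_elim
      case (elim k)
      have k: "0 < real k powr q" using elim(4) by simp
      have "- (4 * \<theta> k) < b k - 1" "b k - 1 < - (11 / 4 * \<theta> k)"
        using elim(1,2) k by (simp_all add: \<theta> powr_minus field_simps)
      moreover have "0 < \<theta> k" using k \<sigma> elim(4) by (simp add: \<theta>)
      moreover have "(b k)\<^sup>2 \<le> (1 - 11 / 4 * \<theta> k)\<^sup>2"
        using calculation elim(3) by (intro power_mono) auto
      moreover have "\<theta> k * \<theta> k \<le> 1/16 * \<theta> k"
        using calculation elim(3) by (intro mult_right_mono) auto
      moreover have "(1 - 11 / 4 * \<theta> k)\<^sup>2 = 1 - 11 / 2 * \<theta> k + 121 / 16 * (\<theta> k * \<theta> k)"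
        by (simp add: power2_eq_square algebra_simps)
      ultimately show ?case using elim(3) by (intro conjI) linarith+
    qed
  qed
  have ev_\<gamma>: "\<forall>\<^sub>F k in sequentially. \<bar>\<gamma> k\<bar> \<le> C * (\<theta> k)\<^sup>2"
  proof -
    have "\<forall>\<^sub>F k in sequentially. \<bar>real k powr (2 * q) * \<gamma> k\<bar> < \<bar>g\<bar> + 1"
      by (intro order_tendstoD(2)[OF tendsto_rabs[OF \<gamma>_lim]]) simp
    then show ?thesis using eventually_gt_at_top[of 0]
    proof eventually_elim
      case (elim k)
      have "C * (\<theta> k)\<^sup>2 = (\<bar>g\<bar> + 1) / real k powr (2 * q)"
      proof -
        have "(real k powr (-q))\<^sup>2 = 1 / real k powr (2 * q)"
          by (simp add: power2_eq_square powr_minus_divide flip: powr_add)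
        then show ?thesis using \<sigma> by (simp add: C_def \<theta> power_mult_distrib)
      qed
      moreover have "\<bar>\<gamma> k\<bar> \<le> (\<bar>g\<bar> + 1) / real k powr (2 * q)"
        using elim by (simp add: abs_mult pos_le_divide_eq mult.commute)
      ultimately show ?case by simp
    qed
  qed

  \<comment> \<open>\<open>\<theta>' k \<le> 2 * \<theta> k\<close> turns the factor 4 of
    \<open>energy_lower_bound\<close> into 16. The part of \<open>h_bound\<close> with
    \<open>F\<close> then costs at most half of \<open>F k\<close>.\<close>
  have lower: "\<forall>\<^sub>F k in sequentially. F k / 2 + (norm (v k))\<^sup>2 / 4 - 16 * C2 * (\<theta> k)\<^sup>2 \<le> M k"
    using ev_\<theta>' ev_double ev_mono h_bound F_nonneg ev_small[of "1/2" "16 * C1", simplified]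
  proof eventually_elim
    case (elim k)
    have \<theta>0: "0 \<le> \<theta> k" using \<sigma> by (simp add: \<theta>)
    have "4 * (\<theta>' k)\<^sup>2 * (norm (h k))\<^sup>2 \<le> 4 * (2 * \<theta> k)\<^sup>2 * (C1 * (real k powr p * F k) + C2)"
      using elim \<theta>0 C by (intro mult_mono power_mono) auto
    also have "\<dots> = (16 * C1 * ((\<theta> k)\<^sup>2 * real k powr p)) * F k + 16 * C2 * (\<theta> k)\<^sup>2"
      by (simp add: algebra_simps power2_eq_square)
    also have "\<dots> \<le> 1/2 * F k + 16 * C2 * (\<theta> k)\<^sup>2"
      using elim by (intro add_right_mono mult_right_mono) auto
    finally show ?case
      using energy_lower_bound[of "\<theta>' k" "v k" "h k"] elim \<theta>0 by (simp add: M_def)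
  qed
  define \<epsilon> where "\<epsilon> k = K2 * (real k powr (p + q) * (\<theta> k)^3) + real k powr (p + q) * \<delta> k" for k
  have "\<forall>\<^sub>F k in sequentially.
      M (Suc k) \<le> (1 - \<sigma> / 2 * real k powr (-q)) * M k + \<epsilon> k * real k powr (-p - q)"
    using ev_\<theta> ev_mono ev_diff ev_b ev_\<gamma> step h_bound lower F_nonneg
      ev_small[of "1/4" "K * C1", simplified] eventually_gt_at_top[of 0]
  proof eventually_elim
    case (elim k)
    have \<theta>0: "0 < \<theta> k" using \<sigma> elim(11) by (simp add: \<theta>)
    have "(norm (d k))\<^sup>2 + 2 * \<theta> k * inner (h k) (d k)
      \<le> (1 - \<theta> k) * ((1 - 2 * \<theta>' k) * (norm (v k))\<^sup>2 + 2 * \<theta>' k * inner (h k) (v k))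
        + K * (\<theta> k)^3 * ((norm (h k))\<^sup>2 + (norm z)\<^sup>2)"
      unfolding K_def using elim \<theta>0 d by (intro energy_step[where b="b k" and \<gamma>="\<gamma> k"]) auto
    then have "M (Suc k) \<le> (1 - \<theta> k) * M k + K * (\<theta> k)^3 * ((norm (h k))\<^sup>2 + (norm z)\<^sup>2) + \<delta> k"
      using elim(6) unfolding M_def \<theta>_shift by (simp add: algebra_simps)
    moreover have "K * (\<theta> k)^3 * ((norm (h k))\<^sup>2 + (norm z)\<^sup>2)
        \<le> K * (\<theta> k)^3 * ((C1 * (real k powr p * F k) + C2) + (norm z)\<^sup>2)"
      using elim(7) K \<theta>0 by (intro mult_left_mono) auto
    moreover have "\<dots> = \<theta> k * ((K * C1 * ((\<theta> k)\<^sup>2 * real k powr p)) * F k)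
        + K * (C2 + (norm z)\<^sup>2) * (\<theta> k)^3"
      by (simp add: algebra_simps power2_eq_square power3_eq_cube)
    \<comment> \<open>A quarter of \<open>F k\<close> costs half of \<open>M k\<close>, up to a term
      of order \<open>\<theta>^3\<close> after multiplication by \<open>\<theta> k\<close>; so the
      rate drops from \<open>\<theta> k\<close> to \<open>\<theta> k / 2\<close>.\<close>
    moreover have "\<theta> k * ((K * C1 * ((\<theta> k)\<^sup>2 * real k powr p)) * F k) \<le> \<theta> k * (1/4 * F k)"
      using elim \<theta>0 by (intro mult_left_mono mult_right_mono) auto
    moreover have "\<theta> k * (1/4 * F k) \<le> \<theta> k * (1/4 * (2 * M k + 32 * C2 * (\<theta> k)\<^sup>2))"
      using elim(8) \<theta>0 zero_le_power2[of "norm (v k)"] by (intro mult_left_mono) linarith+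
    ultimately have "M (Suc k) \<le> (1 - \<theta> k / 2) * M k + K2 * (\<theta> k)^3 + \<delta> k"
      by (simp add: K2_def algebra_simps power2_eq_square power3_eq_cube)
    moreover have "\<epsilon> k * real k powr (-p - q) = K2 * (\<theta> k)^3 + \<delta> k"
    proof -
      have "real k powr (p + q) * real k powr (-p - q) = 1"
        using elim(11) by (simp flip: powr_add)
      moreover have "\<epsilon> k * real k powr (-p - q)
          = (K2 * (\<theta> k)^3 + \<delta> k) * (real k powr (p + q) * real k powr (-p - q))"
        by (simp only: \<epsilon>_def algebra_simps)
      ultimately show ?thesis by simp
    qed
    ultimately show ?case by (simp add: \<theta>)
  qed
  moreover have "\<epsilon> \<longlonglongrightarrow> 0"
    unfolding \<epsilon>_def by (intro tendsto_add_zero tendsto_mult_right_zero \<theta>3_lim \<delta>_lim)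
  ultimately have "(\<lambda>k. real k powr p * max 0 (M k)) \<longlonglongrightarrow> 0"
    using q p \<sigma> by (intro powr_recurrence_tendsto_0[where A="\<sigma> / 2"]) auto
  then have lim: "(\<lambda>k. 4 * (real k powr p * max 0 (M k)) + 64 * C2 * ((\<theta> k)\<^sup>2 * real k powr p)) \<longlonglongrightarrow> 0"
    by (intro tendsto_add_zero tendsto_mult_right_zero \<theta>2_lim)
  have bound: "\<forall>\<^sub>F k in sequentially. real k powr p * F k + real k powr p * (norm (v k))\<^sup>2
     \<le> 4 * (real k powr p * max 0 (M k)) + 64 * C2 * ((\<theta> k)\<^sup>2 * real k powr p)"
    using lower F_nonneg
  proof eventually_elim
    case (elim k)
    then have "F k + (norm (v k))\<^sup>2 \<le> 4 * max 0 (M k) + 64 * C2 * (\<theta> k)\<^sup>2" by linarith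
    from mult_left_mono[OF this, of "real k powr p"] show ?case by (simp add: algebra_simps)
  qed
  show "(\<lambda>k. real k powr p * F k) \<longlonglongrightarrow> 0"
    by (rule Lim_null_comparison[OF _ lim], use bound F_nonneg in eventually_elim)
       (smt (verit) real_norm_def mult_nonneg_nonneg powr_ge_zero zero_le_power2)
  show "(\<lambda>k. real k powr p * (norm (v k))\<^sup>2) \<longlonglongrightarrow> 0"
    by (rule Lim_null_comparison[OF _ lim], use bound F_nonneg in eventually_elim)
       (smt (verit) real_norm_def mult_nonneg_nonneg powr_ge_zero zero_le_power2)
qed

section \<open>Asymptotics of the coefficients\<close>

lemma eventually_not_exceptional: "\<forall>\<^sub>F k in sequentially. \<not> exceptional c s p k"
proof -
  define r where "r = max 1 ((c * s) powr (1 / p) + 1)"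
  have "\<forall>\<^sub>F k in sequentially. r < real k" by real_asymp
  then show ?thesis by eventually_elim (auto simp: exceptional_def r_def)
qed

text \<open>The difference of consecutive negative powers is of order \<open>k powr (-p - 1)\<close>
  and the relative increment of \<open>k powr q\<close> is of order \<open>1 / k\<close>; since
  \<open>q < 1\<close>, both vanish even after multiplication by \<open>k powr q\<close>.\<close>

lemma powr_shift_limits:
  fixes p q :: real
  assumes "0 < q" "q < 1" "0 < p"
  shows "(\<lambda>k::nat. real k powr q * (1 / (real k - 1) powr p - 1 / real k powr p)) \<longlonglongrightarrow> 0"
    and "(\<lambda>k::nat. real k powr q * ((real k - 1) powr q / real k powr q - 1)) \<longlonglongrightarrow> 0"
    and "(\<lambda>k::nat. real k powr q / (real k - 1) powr q) \<longlonglongrightarrow> 1"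
    and "(\<lambda>k::nat. (real k - 1) powr q / real k powr q) \<longlonglongrightarrow> 1"
    and "(\<lambda>k::nat. 1 / real k powr p) \<longlonglongrightarrow> 0"
    and "(\<lambda>k::nat. 1 / (real k - 1) powr p) \<longlonglongrightarrow> 0"
proof -
  let ?X = "\<lambda>k::nat. 1 / (real k - 1) powr p - 1 / real k powr p"
  have "(\<lambda>k. real k powr (-p)) \<longlonglongrightarrow> 0" "(\<lambda>k. real k powr (p + q) * ?X k) \<longlonglongrightarrow> 0"
    using assms by (real_asymp, real_asymp)
  then have "(\<lambda>k. real k powr (-p) * (real k powr (p + q) * ?X k)) \<longlonglongrightarrow> 0"
    by (rule tendsto_mult_zero)
  moreover have "real k powr (-p) * (real k powr (p + q) * ?X k) = real k powr q * ?X k" for k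
    by (simp add: mult.assoc[symmetric] flip: powr_add)
  ultimately show "(\<lambda>k. real k powr q * ?X k) \<longlonglongrightarrow> 0" by simp
qed (use assms in real_asymp)+

lemma eventually_powr_shift_gt:
  fixes p r :: real
  assumes "0 < p"
  shows "\<forall>\<^sub>F k::nat in sequentially. r < real k powr p \<and> r < (real k - 1) powr p"
proof -
  have "\<forall>\<^sub>F k::nat in sequentially. r < real k powr p" using assms by real_asymp
  moreover have "\<forall>\<^sub>F k::nat in sequentially. r < (real k - 1) powr p" using assms by real_asymp
  ultimately show ?thesis by eventually_elim simp
qed

text \<open>With the normalized factors \<open>D\<close>, \<open>D'\<close>, \<open>R\<close> the
  coefficient is \<open>R * D' / D - 2 * s * R / (a * (k - 1) powr q * D' * D)\<close>. The first
  summand contributes \<open>- s / a\<close> to the limit, through \<open>R\<close>, and the second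
  \<open>- 2 * s / a\<close>.\<close>

lemma b_prev_tendsto:
  assumes "0 < q" "q < 1" "0 < p" "0 < a"
  shows "(\<lambda>k. real k powr q * (b_prev a c s p q k - 1)) \<longlonglongrightarrow> - (3 * s / a)"
proof -
  define D where "D k = 1 - c * s * (1 / real k powr p)" for k :: nat
  define D' where "D' k = 1 - c * s * (1 / (real k - 1) powr p)" for k :: nat
  define R where "R k = (real k - 1) powr q / real k powr q - s / a * (1 / real k powr q)" for k :: nat
  note lims = powr_shift_limits[OF assms(1-3)]
  have "D \<longlonglongrightarrow> 1 - c * s * 0" "D' \<longlonglongrightarrow> 1 - c * s * 0" "R \<longlonglongrightarrow> 1 - s / a * 0"
    unfolding D_def D'_def R_def
    \<comment> \<open>The instance with \<open>q\<close> in place of \<open>p\<close> supplies the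
      limit of \<open>1 / k powr q\<close>.\<close>
    by (intro tendsto_intros lims powr_shift_limits(5)[OF assms(1,2,1)])+
  then have DR: "D \<longlonglongrightarrow> 1" "D' \<longlonglongrightarrow> 1" "R \<longlonglongrightarrow> 1" by simp_all
  have "(\<lambda>k. (- (c * s) * (real k powr q * (1 / (real k - 1) powr p - 1 / real k powr p)) / D k) * R k
      + real k powr q * ((real k - 1) powr q / real k powr q - 1) - s / a
      - 2 * s / a * (real k powr q / (real k - 1) powr q) / (D' k * D k) * R k)
    \<longlonglongrightarrow> (- (c * s) * 0 / 1) * 1 + 0 - s / a - 2 * s / a * 1 / (1 * 1) * 1"
    by (intro tendsto_intros lims DR) simp_all
  moreover have "\<forall>\<^sub>F k in sequentially.
      (- (c * s) * (real k powr q * (1 / (real k - 1) powr p - 1 / real k powr p)) / D k) * R k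
      + real k powr q * ((real k - 1) powr q / real k powr q - 1) - s / a
      - 2 * s / a * (real k powr q / (real k - 1) powr q) / (D' k * D k) * R k
      = real k powr q * (b_prev a c s p q k - 1)"
    using eventually_powr_shift_gt[OF \<open>0 < p\<close>, of "max 0 (c * s)"]
      eventually_powr_shift_gt[OF \<open>0 < q\<close>, of 0] eventually_not_exceptional[of c s p]
  proof eventually_elim
    case (elim k)
    \<comment> \<open>Naming the powers turns the claim into an identity of rational
      functions.\<close>
    define P P' Q Q' e where "P = real k powr p" "P' = (real k - 1) powr p"
      "Q = real k powr q" "Q' = (real k - 1) powr q" "e = c * s"
    note abb = P_P'_Q_Q'_e_def
    have "0 < Q" "0 < Q'" "0 < P" "0 < P'" "P - e \<noteq> 0" "P' - e \<noteq> 0" "P \<noteq> e" "P' \<noteq> e" using elim by (auto simp: abb)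
    moreover have "(real k - 1) powr (q + p) = Q' * P'" "(real k - 1) powr (2 * p) = P'\<^sup>2"
      by (simp_all add: abb powr_add power2_eq_square flip: powr_add)
    ultimately show ?case using \<open>0 < a\<close> elim(3)
      unfolding b_prev_def Let_def D_def D'_def R_def abb(5)[symmetric]
      by (simp flip: abb(1-4)) (simp add: divide_simps, simp add: algebra_simps power2_eq_square)
  qed
  ultimately show ?thesis by (simp add: tendsto_cong)
qed

text \<open>Factoring \<open>k powr p * (k - 1) powr p\<close> out of the bracket in the numerator
  leaves \<open>D k\<close> minus \<open>a * c * (k - 1) powr q\<close> times a difference of
  consecutive inverse powers; the latter product vanishes.\<close>

lemma c_coef_tendsto:
  assumes "0 < q" "q < 1" "0 < p" "0 < a"
  shows "(\<lambda>k. real k powr (2 * q) * c_coef a c s p q k) \<longlonglongrightarrow> 2 * s\<^sup>2 / a\<^sup>2"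
proof -
  define D where "D k = 1 - c * s * (1 / real k powr p)" for k :: nat
  define D' where "D' k = 1 - c * s * (1 / (real k - 1) powr p)" for k :: nat
  note lims = powr_shift_limits[OF assms(1-3)]
  have "D \<longlonglongrightarrow> 1 - c * s * 0" "D' \<longlonglongrightarrow> 1 - c * s * 0"
    unfolding D_def D'_def by (intro tendsto_intros lims)+
  then have DD: "D \<longlonglongrightarrow> 1" "D' \<longlonglongrightarrow> 1" by simp_all
  have "(\<lambda>k. 2 * s\<^sup>2 / a\<^sup>2 * (real k powr q / (real k - 1) powr q)
      * (D k - a * c * (((real k - 1) powr q / real k powr q)
          * (real k powr q * (1 / (real k - 1) powr p - 1 / real k powr p)))) / (D' k * (D k)\<^sup>2))
    \<longlonglongrightarrow> 2 * s\<^sup>2 / a\<^sup>2 * 1 * (1 - a * c * (1 * 0)) / (1 * 1\<^sup>2)"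
    by (intro tendsto_intros lims DD) simp_all
  moreover have "\<forall>\<^sub>F k in sequentially.
      2 * s\<^sup>2 / a\<^sup>2 * (real k powr q / (real k - 1) powr q)
      * (D k - a * c * (((real k - 1) powr q / real k powr q)
          * (real k powr q * (1 / (real k - 1) powr p - 1 / real k powr p)))) / (D' k * (D k)\<^sup>2)
      = real k powr (2 * q) * c_coef a c s p q k"
    using eventually_powr_shift_gt[OF \<open>0 < p\<close>, of "max 0 (c * s)"]
      eventually_powr_shift_gt[OF \<open>0 < q\<close>, of 0] eventually_not_exceptional[of c s p]
  proof eventually_elim
    case (elim k)
    define P P' Q Q' e where "P = real k powr p" "P' = (real k - 1) powr p"
      "Q = real k powr q" "Q' = (real k - 1) powr q" "e = c * s"
    note abb = P_P'_Q_Q'_e_def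
    have "0 < Q" "0 < Q'" "0 < P" "0 < P'" "P - e \<noteq> 0" "P' - e \<noteq> 0" "P \<noteq> e" "P' \<noteq> e" using elim by (auto simp: abb)
    moreover have "(real k - 1) powr (q + p) = Q' * P'" "real k powr (2 * q) = Q\<^sup>2"
      by (simp_all add: abb powr_add power2_eq_square flip: powr_add)
    ultimately show ?case using \<open>0 < a\<close> elim(3)
      unfolding c_coef_def Let_def D_def D'_def abb(5)[symmetric]
      by (simp flip: abb(1-4)) (simp add: divide_simps, simp add: algebra_simps power2_eq_square)
  qed
  ultimately show ?thesis by (simp add: tendsto_cong)
qed

section \<open>From limits to Landau symbols\<close>

lemma smallo_powrI:
  assumes "(\<lambda>k. real k powr r * u k) \<longlonglongrightarrow> 0"
  shows "u \<in> o(\<lambda>k. real k powr (- r))"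
proof (rule smalloI_tendsto)
  show "(\<lambda>k. u k / real k powr (- r)) \<longlonglongrightarrow> 0"
    using assms by (simp add: powr_minus_divide mult.commute)
  show "\<forall>\<^sub>F k in sequentially. real k powr (- r) \<noteq> 0"
    using eventually_gt_at_top[of 0] by eventually_elim simp
qed

lemma bigo_powrI:
  assumes "\<forall>\<^sub>F k in sequentially. real k powr r * \<bar>u k\<bar> \<le> C"
  shows "u \<in> O(\<lambda>k. real k powr (- r))"
  using assms eventually_gt_at_top[of 0]
  by (intro bigoI[of _ C], eventually_elim) (simp add: powr_minus_divide field_simps)

lemma powr_half_norm_tendsto_0:
  fixes w :: "nat \<Rightarrow> 'a::real_normed_vector"
  assumes "(\<lambda>k. real k powr p * (norm (w k))\<^sup>2) \<longlonglongrightarrow> 0"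
  shows "(\<lambda>k. real k powr (p / 2) * norm (w k)) \<longlonglongrightarrow> 0"
proof -
  have "real k powr p = (real k powr (p / 2))\<^sup>2" for k
    by (simp add: power2_eq_square flip: powr_add)
  then have "sqrt (real k powr p * (norm (w k))\<^sup>2) = real k powr (p / 2) * norm (w k)" for k
    by (simp add: real_sqrt_mult)
  then show ?thesis using tendsto_real_sqrt[OF assms] by simp
qed

theorem theorem6:
  fixes f :: "'a::{real_inner,complete_space} \<Rightarrow> real"
    and grad :: "'a \<Rightarrow> 'a"
    and x y :: "nat \<Rightarrow> 'a"
    and L a c p q s :: real
  assumes convex: "convex_on UNIV f"
    and gradient: "\<And>z. GDERIV f z :> grad z"
    and gradient_cont: "continuous_on UNIV grad"
    and gradient_lipschitz: "L-lipschitz_on UNIV grad"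
    and L_pos: "L > 0"
    and argmin_nonempty: "argmin f \<noteq> {}"
    and a_pos: "a > 0" and c_pos: "c > 0"
    and q_range: "0 < q" "q < 1"
    and p_range: "0 < p" "p < 2 * q"
    and s_range: "s \<in> {0<..<1 / L}"
    and y_step: "\<And>k. k \<ge> 1 \<Longrightarrow>
      y k = x k + b_prev a c s p q k *\<^sub>R (x k - x (k - 1)) - c_coef a c s p q k *\<^sub>R x k"
    and x_step: "\<And>k. k \<ge> 1 \<Longrightarrow>
      x (k + 1) = y k - s *\<^sub>R grad (y k) - (c * s / real k powr p) *\<^sub>R y k"
  shows "(\<exists>xs. is_arg_min norm (\<lambda>z. z \<in> argmin f) xs
            \<and> x \<longlonglongrightarrow> xs \<and> y \<longlonglongrightarrow> xs)
    \<and> (\<lambda>k. tikhonov f c p k (x k) - tikhonov f c p k (tikhonov_min f c p k))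
        \<in> o(\<lambda>k. real k powr (- p))
    \<and> (\<lambda>k. f (x k) - (INF z. f z)) \<in> O(\<lambda>k. real k powr (- p))
    \<and> (\<lambda>k. f (y k) - (INF z. f z)) \<in> O(\<lambda>k. real k powr (- p))
    \<and> (\<lambda>k. norm (x k - x (k - 1))) \<in> o(\<lambda>k. real k powr (- p / 2))
    \<and> (\<lambda>k. norm (grad (x k))) \<in> o(\<lambda>k. real k powr (- p / 2))
    \<and> (\<lambda>k. norm (grad (y k))) \<in> o(\<lambda>k. real k powr (- p / 2))"
proof -

  \<comment> \<open>The regularized minimizers and their limit\<close>
  define \<mu> where "\<mu> k = c / real k powr p" for k :: nat
  define X where "X = tikhonov_min f c p"
  define E where "E k = tikhonov f c p k (x k) - tikhonov f c p k (X k)" for k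
  have s: "0 < s" "s * L < 1" using s_range L_pos by (auto simp: field_simps)
  have tik: "tikhonov f c p k z = f z + \<mu> k / 2 * (norm z)\<^sup>2" for k z
    by (simp add: tikhonov_def \<mu>_def)
  \<comment> \<open>At \<open>k = 0\<close> the weight is 0, since \<open>0 powr p = 0\<close> and
    division by zero gives 0. Hence the bound \<open>1 \<le> k\<close> throughout and the shift by
    \<open>Suc\<close> in the path argument.\<close>
  have \<mu>_pos: "0 < \<mu> k" if "1 \<le> k" for k using that c_pos by (simp add: \<mu>_def)
  have argmin_iff: "u \<in> argmin g \<longleftrightarrow> (\<forall>z. g u \<le> g z)" for u and g :: "'a \<Rightarrow> real"
    by (simp add: argmin_def is_arg_min_linorder)
  obtain z0 where z0: "\<And>z. f z0 \<le> f z" using argmin_nonempty argmin_iff by blast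

  have X: "f (X k) + \<mu> k / 2 * (norm (X k))\<^sup>2 + \<mu> k / 2 * (norm (z - X k))\<^sup>2
      \<le> f z + \<mu> k / 2 * (norm z)\<^sup>2" if k: "1 \<le> k" for k z
  proof -
    obtain u where u: "\<And>z. f u + \<mu> k / 2 * (norm u)\<^sup>2 + \<mu> k / 2 * (norm (z - u))\<^sup>2
        \<le> f z + \<mu> k / 2 * (norm z)\<^sup>2"
      using regularized_minimizer_exists[OF convex gradient z0 \<mu>_pos[OF k]] by blast
    have nn: "0 \<le> \<mu> k / 2 * (norm w)\<^sup>2" for w :: 'a using \<mu>_pos[OF k] by simp
    \<comment> \<open>Quadratic growth at \<open>u\<close> makes the minimizer unique, so the
      definite description denotes it.\<close>
    have "X k = u"
      unfolding X_def tikhonov_min_def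
    proof (rule the_equality)
      show "u \<in> argmin (tikhonov f c p k)"
        unfolding argmin_iff tik using u nn by (smt (verit))
      fix w assume "w \<in> argmin (tikhonov f c p k)"
      then have "f w + \<mu> k / 2 * (norm w)\<^sup>2 \<le> f u + \<mu> k / 2 * (norm u)\<^sup>2"
        unfolding argmin_iff tik by blast
      then have "\<mu> k / 2 * (norm (w - u))\<^sup>2 \<le> 0" using u[of w] by linarith
      then show "w = u" using \<mu>_pos[OF k] by (simp add: mult_le_0_iff)
    qed
    then show ?thesis using u by simp
  qed

  have \<mu>_lim: "\<mu> \<longlonglongrightarrow> 0" unfolding \<mu>_def using p_range(1) by real_asymp
  obtain xs where xs: "is_arg_min norm (\<lambda>z. z \<in> argmin f) xs" and X_lim: "X \<longlonglongrightarrow> xs"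
  proof -
    have "isCont f z" for z
      using gradient[of z] has_derivative_continuous unfolding gderiv_def by blast
    moreover have "decseq (\<lambda>k. \<mu> (Suc k))"
      using c_pos p_range(1) unfolding \<mu>_def decseq_def
      by (auto intro!: divide_left_mono powr_mono2 mult_pos_pos)
    ultimately obtain xs where "is_arg_min norm (\<lambda>z. z \<in> argmin f) xs" "(\<lambda>k. X (Suc k)) \<longlonglongrightarrow> xs"
      using regularization_path_tendsto[of f "\<lambda>k. X (Suc k)" "\<lambda>k. \<mu> (Suc k)"]
        X \<mu>_pos argmin_nonempty LIMSEQ_Suc[OF \<mu>_lim] by (metis One_nat_def Suc_le_mono le0)
    then show ?thesis using that by (simp add: filterlim_sequentially_Suc)
  qed
  have f_xs: "f xs \<le> f z" for z
    using xs unfolding is_arg_min_linorder argmin_iff by blast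
  have X_le: "norm (X k) \<le> norm xs" if k: "1 \<le> k" for k
  proof -
    have "0 \<le> \<mu> k / 2 * (norm (xs - X k))\<^sup>2" using \<mu>_pos[OF k] by simp
    then have "\<mu> k / 2 * (norm (X k))\<^sup>2 \<le> \<mu> k / 2 * (norm xs)\<^sup>2"
      using X[OF k, of xs] f_xs[of "X k"] by linarith
    then show ?thesis using \<mu>_pos[OF k] by simp
  qed
  have E_ge: "\<mu> k / 2 * (norm (x k - X k))\<^sup>2 \<le> E k" if "1 \<le> k" for k
    using X[OF that, of "x k"] by (simp add: E_def tik)
  have E_nonneg: "0 \<le> E k" if "1 \<le> k" for k
    using E_ge[OF that] \<mu>_pos[OF that] by (smt (verit) mult_nonneg_nonneg zero_le_power2 half_gt_zero_iff)

  \<comment> \<open>Energy inequality for the iterates\<close>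
  define \<theta> where "\<theta> k = s / a * real k powr (- q)" for k :: nat
  define F where "F k = 2 * s * E k" for k
  define h where "h k = x k - xs" for k
  define v where "v k = x k - x (k - 1)" for k
  define d where "d k = b_prev a c s p q k *\<^sub>R v k - c_coef a c s p q k *\<^sub>R (h k + xs)" for k
  \<comment> \<open>The drift has two sources: the weight decreases from \<open>\<mu> k\<close> to
    \<open>\<mu> (Suc k)\<close>, and the comparison point \<open>xs\<close> is not the minimizer
    \<open>X k\<close> of the regularized function.\<close>
  define \<delta> where "\<delta> k = s * (c * (norm xs)\<^sup>2 * (real k powr (- p) - (real k + 1) powr (- p))
      + \<theta> k * (c * real k powr (- p) * ((norm xs)\<^sup>2 - (norm (X k))\<^sup>2)))" for k
  have d_eq: "d k = y k - x k" if "1 \<le> k" for k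
    using y_step[OF that] by (simp add: d_def v_def h_def)
  have ev_smooth: "\<forall>\<^sub>F k in sequentially. s * (L + \<mu> k) \<le> 1"
  proof -
    have "(\<lambda>k. s * (L + \<mu> k)) \<longlonglongrightarrow> s * (L + 0)" by (intro tendsto_intros \<mu>_lim)
    then have "\<forall>\<^sub>F k in sequentially. s * (L + \<mu> k) < 1" using s(2) by (intro order_tendstoD(2)) auto
    then show ?thesis by eventually_elim simp
  qed
  have ev_\<theta>: "\<forall>\<^sub>F k in sequentially. \<theta> k \<le> 1"
    unfolding \<theta>_def using s(1) a_pos q_range by real_asymp

  have step: "\<forall>\<^sub>F k in sequentially.
      F (Suc k) + (1 - 2 * \<theta> k) * (norm (v (Suc k)))\<^sup>2 + 2 * \<theta> k * inner (h (Suc k)) (v (Suc k))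
      \<le> (1 - \<theta> k) * F k + (norm (d k))\<^sup>2 + 2 * \<theta> k * inner (h k) (d k) + \<delta> k"
    using ev_smooth ev_\<theta> eventually_ge_at_top[of 1]
  proof eventually_elim
    case (elim k)
    note k = \<open>1 \<le> k\<close>
    let ?m = "\<lambda>k. f (X k) + \<mu> k / 2 * (norm (X k))\<^sup>2"
    have \<theta>0: "0 \<le> \<theta> k" using s(1) a_pos by (simp add: \<theta>_def)
    have x': "x (Suc k) = y k - s *\<^sub>R (grad (y k) + \<mu> k *\<^sub>R y k)"
      using x_step[OF k] by (simp add: \<mu>_def scaleR_add_right mult.commute)
    have dec: "\<mu> (Suc k) \<le> \<mu> k"
      using k c_pos p_range(1) unfolding \<mu>_def
      by (auto intro!: divide_left_mono powr_mono2 mult_pos_pos)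
    have "2 * s * (f (x (Suc k)) + \<mu> k / 2 * (norm (x (Suc k)))\<^sup>2)
        + (1 - 2 * \<theta> k) * (norm (v (Suc k)))\<^sup>2 + 2 * \<theta> k * inner (h (Suc k)) (v (Suc k))
      \<le> 2 * s * ((1 - \<theta> k) * (f (x k) + \<mu> k / 2 * (norm (x k))\<^sup>2)
          + \<theta> k * (f xs + \<mu> k / 2 * (norm xs)\<^sup>2))
        + (norm (d k))\<^sup>2 + 2 * \<theta> k * inner (h k) (d k)"
      using accelerated_step_energy[OF convex gradient gradient_lipschitz _ s(1) elim(1) \<theta>0 elim(2) x',
          of "x k" xs] \<mu>_pos[OF k] by (simp add: v_def h_def d_eq[OF k])
    \<comment> \<open>The gradient step uses the weight \<open>\<mu> k\<close>, the next gap uses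
      \<open>\<mu> (Suc k)\<close>; lowering the weight only decreases the value at
      \<open>x (Suc k)\<close>.\<close>
    moreover have "F (Suc k)
        \<le> 2 * s * (f (x (Suc k)) + \<mu> k / 2 * (norm (x (Suc k)))\<^sup>2) - 2 * s * ?m (Suc k)"
    proof -
      have "\<mu> (Suc k) / 2 * (norm (x (Suc k)))\<^sup>2 \<le> \<mu> k / 2 * (norm (x (Suc k)))\<^sup>2"
        using dec by (intro mult_right_mono) auto
      then have "2 * s * E (Suc k) \<le> 2 * s * ((f (x (Suc k)) + \<mu> k / 2 * (norm (x (Suc k)))\<^sup>2) - ?m (Suc k))"
        using s(1) unfolding E_def tik by (intro mult_left_mono) auto
      then show ?thesis by (simp add: F_def right_diff_distrib)
    qed
    moreover have "2 * s * (?m k - ?m (Suc k) + \<theta> k * ((f xs + \<mu> k / 2 * (norm xs)\<^sup>2) - ?m k)) \<le> \<delta> k"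
    proof -
      \<comment> \<open>Testing the minimality of \<open>X k\<close> at \<open>X (Suc k)\<close>
        reduces the change of the minimal value to the change of the weight.\<close>
      have "0 \<le> \<mu> k / 2 * (norm (X (Suc k) - X k))\<^sup>2" using \<mu>_pos[OF k] by simp
      then have "?m k - ?m (Suc k) \<le> (\<mu> k - \<mu> (Suc k)) / 2 * (norm (X (Suc k)))\<^sup>2"
        using X[OF k, of "X (Suc k)"] by (simp add: field_simps)
      also have "\<dots> \<le> (\<mu> k - \<mu> (Suc k)) / 2 * (norm xs)\<^sup>2"
        using dec X_le[of "Suc k"] by (intro mult_left_mono power_mono) auto
      finally have "?m k - ?m (Suc k) \<le> (\<mu> k - \<mu> (Suc k)) / 2 * (norm xs)\<^sup>2" .
      moreover have "\<theta> k * ((f xs + \<mu> k / 2 * (norm xs)\<^sup>2) - ?m k)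
          \<le> \<theta> k * (\<mu> k / 2 * ((norm xs)\<^sup>2 - (norm (X k))\<^sup>2))"
        using \<theta>0 f_xs[of "X k"] by (intro mult_left_mono) (auto simp: algebra_simps)
      ultimately have "2 * s * (?m k - ?m (Suc k) + \<theta> k * ((f xs + \<mu> k / 2 * (norm xs)\<^sup>2) - ?m k))
        \<le> 2 * s * ((\<mu> k - \<mu> (Suc k)) / 2 * (norm xs)\<^sup>2
            + \<theta> k * (\<mu> k / 2 * ((norm xs)\<^sup>2 - (norm (X k))\<^sup>2)))"
        using s(1) by (intro mult_left_mono[OF add_mono]) (assumption | simp)+
      also have "\<dots> = \<delta> k"
        by (simp add: \<delta>_def \<mu>_def powr_minus_divide add.commute[of _ 1] algebra_simps
            diff_divide_distrib)
      finally show ?thesis .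
    qed
    moreover have "2 * s * ((1 - \<theta> k) * (f (x k) + \<mu> k / 2 * (norm (x k))\<^sup>2)
          + \<theta> k * (f xs + \<mu> k / 2 * (norm xs)\<^sup>2))
        = (1 - \<theta> k) * F k + 2 * s * ?m (Suc k)
          + 2 * s * (?m k - ?m (Suc k) + \<theta> k * ((f xs + \<mu> k / 2 * (norm xs)\<^sup>2) - ?m k))"
    proof -
      have "2 * s * ((1 - t) * A + t * B)
          = (1 - t) * (2 * s * (A - m)) + 2 * s * m' + 2 * s * (m - m' + t * (B - m))"
        for t A B m m' :: real
        by algebra
      then show ?thesis unfolding F_def E_def tik .
    qed
    ultimately show ?case by linarith
  qed

  \<comment> \<open>The first part is of order \<open>k powr (q - 1)\<close> after scaling. In the
    second all powers cancel, so it vanishes only because \<open>X\<close> converges to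
    \<open>xs\<close> in norm.\<close>
  have \<delta>_lim: "(\<lambda>k. real k powr (p + q) * \<delta> k) \<longlonglongrightarrow> 0"
  proof -
    have "(\<lambda>k. real k powr (p + q) * (real k powr (- p) - (real k + 1) powr (- p))) \<longlonglongrightarrow> 0"
      using q_range p_range(1) by real_asymp
    moreover have "(\<lambda>k. (norm xs)\<^sup>2 - (norm (X k))\<^sup>2) \<longlonglongrightarrow> (norm xs)\<^sup>2 - (norm xs)\<^sup>2"
      by (intro tendsto_intros X_lim)
    ultimately have "(\<lambda>k. s * c * (norm xs)\<^sup>2 * (real k powr (p + q) * (real k powr (- p) - (real k + 1) powr (- p)))
        + s * s * c / a * ((norm xs)\<^sup>2 - (norm (X k))\<^sup>2)) \<longlonglongrightarrow> 0"
      by (intro tendsto_add_zero tendsto_mult_right_zero) auto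
    moreover have "\<forall>\<^sub>F k in sequentially.
        s * c * (norm xs)\<^sup>2 * (real k powr (p + q) * (real k powr (- p) - (real k + 1) powr (- p)))
        + s * s * c / a * ((norm xs)\<^sup>2 - (norm (X k))\<^sup>2) = real k powr (p + q) * \<delta> k"
      using eventually_gt_at_top[of 0]
    proof eventually_elim
      case (elim k)
      have "real k powr (p + q) * (real k powr (- q) * real k powr (- p)) = 1"
        using elim by (simp flip: powr_add)
      then have "s * s * c / a * ((norm xs)\<^sup>2 - (norm (X k))\<^sup>2)
        = s * s * c / a * ((norm xs)\<^sup>2 - (norm (X k))\<^sup>2)
          * (real k powr (p + q) * (real k powr (- q) * real k powr (- p)))" by simp
      then show ?case by (simp only: \<delta>_def \<theta>_def) (simp add: algebra_simps)
    qed
    ultimately show ?thesis by (rule Lim_transform_eventually)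
  qed

  \<comment> \<open>Strong convexity with modulus \<open>\<mu> k\<close> bounds the distance of
    \<open>x k\<close> to \<open>X k\<close> by the gap; the distance of \<open>X k\<close> to
    \<open>xs\<close> is eventually below 1.\<close>
  have h_bound: "\<forall>\<^sub>F k in sequentially. (norm (h k))\<^sup>2 \<le> 2 / (c * s) * (real k powr p * F k) + 2"
  proof -
    have "\<forall>\<^sub>F k in sequentially. dist (X k) xs < 1" using X_lim by (intro tendstoD) auto
    then show ?thesis using eventually_ge_at_top[of 1]
    proof eventually_elim
      case (elim k)
      have "(norm (x k - X k))\<^sup>2 \<le> 1 / (c * s) * (real k powr p * F k)"
        using E_ge[OF elim(2)] c_pos s(1) elim(2) by (simp add: F_def \<mu>_def field_simps)
      moreover have "(norm (X k - xs))\<^sup>2 \<le> 1"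
        using elim(1) by (simp add: dist_norm abs_square_le_1)
      moreover have "(norm (h k))\<^sup>2 \<le> 2 * (norm (x k - X k))\<^sup>2 + 2 * (norm (X k - xs))\<^sup>2"
      proof -
        have "norm (h k) \<le> norm (x k - X k) + norm (X k - xs)"
          unfolding h_def using norm_triangle_ineq[of "x k - X k" "X k - xs"] by simp
        then have "(norm (h k))\<^sup>2 \<le> (norm (x k - X k) + norm (X k - xs))\<^sup>2"
          by (intro power_mono) auto
        then show ?thesis
          using sum_squares_bound[of "norm (x k - X k)" "norm (X k - xs)"]
          by (simp add: power2_eq_square algebra_simps)
      qed
      ultimately show ?case by simp
    qed
  qed

  \<comment> \<open>Decay of the energy and strong convergence\<close>
  have decay: "(\<lambda>k. real k powr p * F k) \<longlonglongrightarrow> 0" "(\<lambda>k. real k powr p * (norm (v k))\<^sup>2) \<longlonglongrightarrow> 0"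
  proof -
    have "\<forall>\<^sub>F k in sequentially. 0 \<le> F k"
      using eventually_ge_at_top[of 1] by eventually_elim (use E_nonneg s(1) in \<open>simp add: F_def\<close>)
    note * = energy_decay[OF q_range p_range divide_pos_pos[OF s(1) a_pos] \<theta>_def _
        c_coef_tendsto[OF q_range p_range(1) a_pos] this _ _ h_bound \<delta>_lim d_def step]
    show "(\<lambda>k. real k powr p * F k) \<longlonglongrightarrow> 0" "(\<lambda>k. real k powr p * (norm (v k))\<^sup>2) \<longlonglongrightarrow> 0"
      using b_prev_tendsto[OF q_range p_range(1) a_pos, of c s] c_pos s(1)
      by (auto intro!: *)
  qed
  have E_lim: "(\<lambda>k. real k powr p * E k) \<longlonglongrightarrow> 0"
    using tendsto_mult_right_zero[OF decay(1), of "1 / (2 * s)"] s(1) by (simp add: F_def)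

  have x_lim: "x \<longlonglongrightarrow> xs"
  proof -
    \<comment> \<open>The modulus decays like \<open>k powr (-p)\<close>, and the gap is of smaller
      order than that.\<close>
    have "(\<lambda>k. (norm (x k - X k))\<^sup>2) \<longlonglongrightarrow> 0"
    proof (rule Lim_null_comparison[OF _ tendsto_mult_right_zero[OF E_lim, of "2 / c"]])
      show "\<forall>\<^sub>F k in sequentially. norm ((norm (x k - X k))\<^sup>2) \<le> 2 / c * (real k powr p * E k)"
        using eventually_ge_at_top[of 1]
        by eventually_elim (use E_ge c_pos in \<open>auto simp: \<mu>_def field_simps\<close>)
    qed
    then have "(\<lambda>k. x k - X k) \<longlonglongrightarrow> 0"
      using tendsto_real_sqrt by (force intro: tendsto_norm_zero_cancel)
    from tendsto_add[OF this X_lim] show ?thesis by simp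
  qed

  \<comment> \<open>Increments and gradients\<close>
  define R where "R k = real k powr (p / 2)" for k :: nat
  have R2: "R k * R k = real k powr p" for k by (simp add: R_def flip: powr_add)
  have v_lim: "(\<lambda>k. R k * norm (v k)) \<longlonglongrightarrow> 0"
    unfolding R_def by (rule powr_half_norm_tendsto_0[OF decay(2)])
  have norm_x_lim: "(\<lambda>k. norm (x k)) \<longlonglongrightarrow> norm xs" by (intro tendsto_intros x_lim)

  \<comment> \<open>A trial gradient step from \<open>x k\<close>, with \<open>x k\<close> as its
    own comparison point, decreases the regularized function by at least \<open>s / 2\<close> times
    the squared norm of its gradient, and this decrease is at most \<open>E k\<close>. The
    regularizing part of the gradient is of order \<open>k powr (-p)\<close>.\<close>
  have grad_x_lim: "(\<lambda>k. R k * norm (grad (x k))) \<longlonglongrightarrow> 0"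
  proof -
    have "(\<lambda>k. real k powr p * (norm (grad (x k) + \<mu> k *\<^sub>R x k))\<^sup>2) \<longlonglongrightarrow> 0"
    proof (rule Lim_null_comparison[OF _ tendsto_mult_right_zero[OF E_lim, of "2 / s"]])
      show "\<forall>\<^sub>F k in sequentially. norm (real k powr p * (norm (grad (x k) + \<mu> k *\<^sub>R x k))\<^sup>2)
          \<le> 2 / s * (real k powr p * E k)"
        using ev_smooth eventually_ge_at_top[of 1]
      proof eventually_elim
        case (elim k)
        let ?G = "grad (x k) + \<mu> k *\<^sub>R x k" and ?u = "x k - s *\<^sub>R (grad (x k) + \<mu> k *\<^sub>R x k)"
        have "f ?u + \<mu> k / 2 * (norm ?u)\<^sup>2
            \<le> f (x k) + \<mu> k / 2 * (norm (x k))\<^sup>2 - s / 2 * (norm ?G)\<^sup>2"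
          using regularized_gradient_step_le[OF convex gradient gradient_lipschitz _ s(1) elim(1) refl refl,
              of "x k" "x k"] \<mu>_pos[OF elim(2)] by simp
        moreover have "0 \<le> \<mu> k / 2 * (norm (?u - X k))\<^sup>2" using \<mu>_pos[OF elim(2)] by simp
        ultimately have "s / 2 * (norm ?G)\<^sup>2 \<le> E k"
          using X[OF elim(2), of ?u] unfolding E_def tik by linarith
        then have "(norm ?G)\<^sup>2 \<le> 2 / s * E k" using s(1) by (simp add: field_simps)
        from mult_left_mono[OF this, of "real k powr p"] show ?case by (simp add: algebra_simps)
      qed
    qed
    then have "(\<lambda>k. R k * norm (grad (x k) + \<mu> k *\<^sub>R x k)) \<longlonglongrightarrow> 0"
      unfolding R_def by (rule powr_half_norm_tendsto_0)
    moreover have "(\<lambda>k. (R k * \<mu> k) * norm (x k)) \<longlonglongrightarrow> 0 * norm xs"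
    proof (intro tendsto_mult norm_x_lim)
      show "(\<lambda>k. R k * \<mu> k) \<longlonglongrightarrow> 0" unfolding R_def \<mu>_def using p_range(1) by real_asymp
    qed
    ultimately have lim: "(\<lambda>k. R k * norm (grad (x k) + \<mu> k *\<^sub>R x k) + (R k * \<mu> k) * norm (x k)) \<longlonglongrightarrow> 0"
      by (intro tendsto_add_zero) auto
    show ?thesis
    proof (rule Lim_null_comparison[OF always_eventually lim], rule allI)
      fix k
      have "norm (grad (x k)) \<le> norm (grad (x k) + \<mu> k *\<^sub>R x k) + \<mu> k * norm (x k)"
        using norm_triangle_ineq4[of "grad (x k) + \<mu> k *\<^sub>R x k" "\<mu> k *\<^sub>R x k"] c_pos
        by (simp add: \<mu>_def)
      from mult_left_mono[OF this, of "R k"]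
      show "norm (R k * norm (grad (x k)))
          \<le> R k * norm (grad (x k) + \<mu> k *\<^sub>R x k) + (R k * \<mu> k) * norm (x k)"
        by (simp add: R_def algebra_simps)
    qed
  qed

  have d_lim: "(\<lambda>k. R k * norm (d k)) \<longlonglongrightarrow> 0"
  proof -
    have "(\<lambda>k. real k powr (- q)) \<longlonglongrightarrow> 0" using q_range by real_asymp
    from tendsto_mult[OF this b_prev_tendsto[OF q_range p_range(1) a_pos, of c s]]
    have "(\<lambda>k. real k powr (- q) * (real k powr q * (b_prev a c s p q k - 1))) \<longlonglongrightarrow> 0" by simp
    moreover have "\<forall>\<^sub>F k in sequentially.
        real k powr (- q) * (real k powr q * (b_prev a c s p q k - 1)) = b_prev a c s p q k - 1"
      using eventually_gt_at_top[of 0]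
      by eventually_elim (simp add: powr_minus)
    ultimately have "(\<lambda>k. b_prev a c s p q k - 1) \<longlonglongrightarrow> 0" by (rule Lim_transform_eventually)
    then have b: "(\<lambda>k. b_prev a c s p q k) \<longlonglongrightarrow> 1" by (rule LIM_zero_cancel)
    \<comment> \<open>The exponent is negative because \<open>p / 2 < q\<close>.\<close>
    have "(\<lambda>k. real k powr (p / 2 - 2 * q)) \<longlonglongrightarrow> 0" using p_range q_range by real_asymp
    from tendsto_mult[OF this c_coef_tendsto[OF q_range p_range(1) a_pos, of c s]]
    have "(\<lambda>k. real k powr (p / 2 - 2 * q) * (real k powr (2 * q) * c_coef a c s p q k)) \<longlonglongrightarrow> 0" by simp
    moreover have "real k powr (p / 2 - 2 * q) * (real k powr (2 * q) * c_coef a c s p q k)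
        = R k * c_coef a c s p q k" for k
      by (simp add: R_def mult.assoc[symmetric] flip: powr_add)
    ultimately have "(\<lambda>k. R k * c_coef a c s p q k) \<longlonglongrightarrow> 0" by simp
    then have "(\<lambda>k. \<bar>b_prev a c s p q k\<bar> * (R k * norm (v k)) + \<bar>R k * c_coef a c s p q k\<bar> * norm (x k))
        \<longlonglongrightarrow> \<bar>1\<bar> * 0 + \<bar>0\<bar> * norm xs"
      by (intro tendsto_intros b v_lim norm_x_lim)
    then have lim: "(\<lambda>k. \<bar>b_prev a c s p q k\<bar> * (R k * norm (v k))
        + \<bar>R k * c_coef a c s p q k\<bar> * norm (x k)) \<longlonglongrightarrow> 0" by simp
    show ?thesis
    proof (rule Lim_null_comparison[OF always_eventually lim], rule allI)
      fix k
      have "norm (d k) \<le> \<bar>b_prev a c s p q k\<bar> * norm (v k) + \<bar>c_coef a c s p q k\<bar> * norm (x k)"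
        using norm_triangle_ineq4[of "b_prev a c s p q k *\<^sub>R v k" "c_coef a c s p q k *\<^sub>R x k"]
        by (simp add: d_def h_def)
      from mult_left_mono[OF this, of "R k"]
      show "norm (R k * norm (d k))
          \<le> \<bar>b_prev a c s p q k\<bar> * (R k * norm (v k)) + \<bar>R k * c_coef a c s p q k\<bar> * norm (x k)"
        by (simp add: R_def abs_mult algebra_simps)
    qed
  qed

  have y_lim: "y \<longlonglongrightarrow> xs"
  proof -
    have "d \<longlonglongrightarrow> 0"
    proof (rule Lim_null_comparison[OF _ d_lim])
      show "\<forall>\<^sub>F k in sequentially. norm (d k) \<le> R k * norm (d k)"
        using eventually_ge_at_top[of 1]
      proof eventually_elim
        case (elim k)
        then have "1 \<le> R k" using p_range(1) by (simp add: R_def ge_one_powr_ge_zero)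
        then show ?case using mult_right_mono[of 1 "R k" "norm (d k)"] by simp
      qed
    qed
    from tendsto_add[OF x_lim this] have "(\<lambda>k. x k + d k) \<longlonglongrightarrow> xs" by simp
    moreover have "\<forall>\<^sub>F k in sequentially. x k + d k = y k"
      using eventually_ge_at_top[of 1] by eventually_elim (simp add: d_eq)
    ultimately show ?thesis by (rule Lim_transform_eventually)
  qed

  have grad_y_lim: "(\<lambda>k. R k * norm (grad (y k))) \<longlonglongrightarrow> 0"
  proof -
    have lim: "(\<lambda>k. R k * norm (grad (x k)) + L * (R k * norm (d k))) \<longlonglongrightarrow> 0"
      by (intro tendsto_add_zero tendsto_mult_right_zero grad_x_lim d_lim)
    show ?thesis
    proof (rule Lim_null_comparison[OF _ lim])
      show "\<forall>\<^sub>F k in sequentially.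
          norm (R k * norm (grad (y k))) \<le> R k * norm (grad (x k)) + L * (R k * norm (d k))"
        using eventually_ge_at_top[of 1]
      proof eventually_elim
        case (elim k)
        have "norm (grad (y k) - grad (x k)) \<le> L * norm (d k)"
          using lipschitz_onD[OF gradient_lipschitz, of "y k" "x k"] by (simp add: dist_norm d_eq[OF elim])
        then have "norm (grad (y k)) \<le> norm (grad (x k)) + L * norm (d k)"
          using norm_triangle_sub[of "grad (y k)" "grad (x k)"] by linarith
        from mult_left_mono[OF this, of "R k"] show ?case by (simp add: R_def algebra_simps)
      qed
    qed
  qed

  \<comment> \<open>Objective values and conclusion\<close>
  have Inf_f: "(INF z. f z) = f xs"
    using f_xs by (intro cInf_eq_minimum) auto
  \<comment> \<open>Comparing the minimal regularized value with the value at \<open>xs\<close> adds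
    \<open>\<mu> k / 2 * (norm xs)\<^sup>2\<close> to the gap. This term is of order
    \<open>k powr (-p)\<close>, so the estimate gives only a large O.\<close>
  have f_x: "\<forall>\<^sub>F k in sequentially. real k powr p * (f (x k) - f xs) \<le> 1 + c / 2 * (norm xs)\<^sup>2"
  proof -
    have "\<forall>\<^sub>F k in sequentially. real k powr p * E k < 1" by (intro order_tendstoD(2)[OF E_lim]) simp
    then show ?thesis using eventually_ge_at_top[of 1]
    proof eventually_elim
      case (elim k)
      have "0 \<le> \<mu> k / 2 * (norm (xs - X k))\<^sup>2" "0 \<le> \<mu> k / 2 * (norm (x k))\<^sup>2"
        using \<mu>_pos[OF elim(2)] by auto
      then have "f (x k) - f xs \<le> E k + \<mu> k / 2 * (norm xs)\<^sup>2"
        using X[OF elim(2), of xs] unfolding E_def tik by linarith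
      from mult_left_mono[OF this, of "real k powr p"]
      have "real k powr p * (f (x k) - f xs) \<le> real k powr p * E k + c / 2 * (norm xs)\<^sup>2"
        using elim(2) by (simp add: \<mu>_def algebra_simps)
      then show ?case using elim(1) by linarith
    qed
  qed
  \<comment> \<open>The descent lemma from \<open>x k\<close> to \<open>y k\<close> adds products of
    two factors that are each \<open>o(k powr (-p / 2))\<close>.\<close>
  have f_y: "\<forall>\<^sub>F k in sequentially.
      real k powr p * (f (y k) - f xs) \<le> (1 + c / 2 * (norm xs)\<^sup>2) + 1"
  proof -
    have "(\<lambda>k. (R k * norm (grad (x k))) * (R k * norm (d k)) + L / 2 * (R k * norm (d k))\<^sup>2)
        \<longlonglongrightarrow> 0 * 0 + L / 2 * 0\<^sup>2"
      by (intro tendsto_intros grad_x_lim d_lim)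
    then have "\<forall>\<^sub>F k in sequentially.
        (R k * norm (grad (x k))) * (R k * norm (d k)) + L / 2 * (R k * norm (d k))\<^sup>2 < 1"
      by (intro order_tendstoD(2)) auto
    then show ?thesis using f_x eventually_ge_at_top[of 1]
    proof eventually_elim
      case (elim k)
      have "f (y k) \<le> f (x k) + inner (grad (x k)) (d k) + L / 2 * (norm (d k))\<^sup>2"
        using lipschitz_gderiv_le[OF gradient gradient_lipschitz, of "x k" "d k"]
        by (simp add: d_eq[OF elim(3)])
      also have "inner (grad (x k)) (d k) \<le> norm (grad (x k)) * norm (d k)"
        by (rule norm_cauchy_schwarz)
      finally have "f (y k) - f xs
          \<le> (f (x k) - f xs) + (norm (grad (x k)) * norm (d k) + L / 2 * (norm (d k))\<^sup>2)" by simp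
      from mult_left_mono[OF this, of "real k powr p"]
      have "real k powr p * (f (y k) - f xs) \<le> real k powr p * (f (x k) - f xs)
          + (R k * norm (grad (x k)) * (R k * norm (d k)) + L / 2 * (R k * norm (d k))\<^sup>2)"
        by (simp add: R2[symmetric] power2_eq_square algebra_simps)
      then show ?case using elim(1,2) by linarith
    qed
  qed
  have nonneg: "real k powr p * \<bar>f z - f xs\<bar> = real k powr p * (f z - f xs)" for k z
    using f_xs[of z] by simp
  have "(\<lambda>k. f (x k) - (INF z. f z)) \<in> O(\<lambda>k. real k powr (- p))"
    "(\<lambda>k. f (y k) - (INF z. f z)) \<in> O(\<lambda>k. real k powr (- p))"
    using bigo_powrI[of p "\<lambda>k. f (x k) - f xs"] bigo_powrI[of p "\<lambda>k. f (y k) - f xs"] f_x f_y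
    unfolding Inf_f nonneg by blast+
  moreover have "(\<lambda>k. tikhonov f c p k (x k) - tikhonov f c p k (tikhonov_min f c p k))
      \<in> o(\<lambda>k. real k powr (- p))"
    using smallo_powrI[OF E_lim] by (simp add: E_def X_def)
  moreover have "(\<lambda>k. norm (x k - x (k - 1))) \<in> o(\<lambda>k. real k powr (- p / 2))"
    using smallo_powrI[OF v_lim[unfolded R_def]] by (simp add: v_def)
  moreover have "(\<lambda>k. norm (grad (x k))) \<in> o(\<lambda>k. real k powr (- p / 2))"
    using smallo_powrI[OF grad_x_lim[unfolded R_def]] by simp
  moreover have "(\<lambda>k. norm (grad (y k))) \<in> o(\<lambda>k. real k powr (- p / 2))"
    using smallo_powrI[OF grad_y_lim[unfolded R_def]] by simp
  ultimately show ?thesis using xs x_lim y_lim by blast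
qed

end
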